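(* Let $F=\mathbb{Z}/2$ and let $n\ge 6$. Then $(F\wr S_n,\ \mathrm{diag}(F)\times S_n)$ is not a strong Gelfand pair.
   Context: All representations are finite-dimensional over $\mathbb{C}$. For a subgroup $K\leqslant G$ of a finite group, $(G,K)$ is a strong Gelfand pair if $\mathrm{ind}_K^G V$ is multiplicity-free for every irreducible representation $V$ of $K$. $F\wr S_n=F^n\rtimes S_n$, where $S_n$ permutes the coordinates of $F^n$. $\mathrm{diag}(F)\times S_n$ denotes the subgroup $\{(f,\sigma): f\in F^n \text{ constant},\ \sigma\in S_n\}$ of $F\wr S_n$. *)

theory Defs
  imports
    Complex_Main
    "HOL-Library.Function_Algebras"
    "HOL-Algebra.Sym_Groups"
    "HOL-Algebra.Product_Groups"
    "HOL-Algebra.Elementary_Groups"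
begin

section \<open>Finite-dimensional complex representations\<close>

definition linear_between ::
  "(complex \<Rightarrow> 'v::ab_group_add \<Rightarrow> 'v) \<Rightarrow> 'v set \<Rightarrow> (complex \<Rightarrow> 'w::ab_group_add \<Rightarrow> 'w) \<Rightarrow> 'w set
    \<Rightarrow> ('v \<Rightarrow> 'w) \<Rightarrow> bool" where
  "linear_between s V t W T \<longleftrightarrow>
     T \<in> V \<rightarrow> W \<and> (\<forall>v\<in>V. \<forall>w\<in>V. T (v + w) = T v + T w) \<and> (\<forall>c. \<forall>v\<in>V. T (s c v) = t c (T v))"

text \<open>The representation space is a subspace \<open>V\<close> of an ambient complex vector space (the whole
  type \<open>'v\<close> with scaling \<open>scale\<close>); \<open>\<rho> g\<close> is only relevant for \<open>g\<close> in \<open>G\<close> and as a map on \<open>V\<close>.\<close>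

locale fd_rep = group G + vector_space scale
  for G (structure) and scale :: "complex \<Rightarrow> 'v::ab_group_add \<Rightarrow> 'v" +
  fixes V :: "'v set" and \<rho> :: "'a \<Rightarrow> 'v \<Rightarrow> 'v"
  assumes subspace_V: "subspace V"
    and finite_dim_V: "\<exists>B. finite B \<and> span B = V"
    and rho_linear: "g \<in> carrier G \<Longrightarrow> linear_between scale V scale V (\<rho> g)"
    and rho_one: "v \<in> V \<Longrightarrow> \<rho> \<one> v = v"
    and rho_mult: "g \<in> carrier G \<Longrightarrow> h \<in> carrier G \<Longrightarrow> v \<in> V \<Longrightarrow> \<rho> (g \<otimes> h) v = \<rho> g (\<rho> h v)"

definition irreducible_rep ::
  "('g, 'm) monoid_scheme \<Rightarrow> (complex \<Rightarrow> 'v::ab_group_add \<Rightarrow> 'v) \<Rightarrow> 'v set \<Rightarrow> ('g \<Rightarrow> 'v \<Rightarrow> 'v) \<Rightarrow> bool" where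
  "irreducible_rep G s V \<rho> \<longleftrightarrow>
     fd_rep G s V \<rho> \<and> V \<noteq> {0} \<and> (\<forall>U. U \<subseteq> V \<and> fd_rep G s U \<rho> \<longrightarrow> U = {0} \<or> U = V)"

definition isomorphic_reps ::
  "('g, 'm) monoid_scheme \<Rightarrow> (complex \<Rightarrow> 'v::ab_group_add \<Rightarrow> 'v) \<Rightarrow> 'v set \<Rightarrow> ('g \<Rightarrow> 'v \<Rightarrow> 'v)
    \<Rightarrow> (complex \<Rightarrow> 'w::ab_group_add \<Rightarrow> 'w) \<Rightarrow> 'w set \<Rightarrow> ('g \<Rightarrow> 'w \<Rightarrow> 'w) \<Rightarrow> bool" where
  "isomorphic_reps G s V \<rho> t W \<tau> \<longleftrightarrow>
     (\<exists>T. linear_between s V t W T \<and> bij_betw T V W \<and>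
          (\<forall>g\<in>carrier G. \<forall>v\<in>V. T (\<rho> g v) = \<tau> g (T v)))"

definition internal_direct_sum :: "'v::ab_group_add set \<Rightarrow> 'i set \<Rightarrow> ('i \<Rightarrow> 'v set) \<Rightarrow> bool" where
  "internal_direct_sum V I U \<longleftrightarrow>
     (\<forall>i\<in>I. U i \<subseteq> V) \<and> (\<forall>v\<in>V. \<exists>!u. u \<in> (\<Pi>\<^sub>E i\<in>I. U i) \<and> (\<Sum>i\<in>I. u i) = v)"

definition multiplicity_free ::
  "('g, 'm) monoid_scheme \<Rightarrow> (complex \<Rightarrow> 'v::ab_group_add \<Rightarrow> 'v) \<Rightarrow> 'v set \<Rightarrow> ('g \<Rightarrow> 'v \<Rightarrow> 'v) \<Rightarrow> bool" where
  "multiplicity_free G s V \<rho> \<longleftrightarrow>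
     (\<exists>(r::nat) U. internal_direct_sum V {..<r} U \<and>
        (\<forall>i<r. irreducible_rep G s (U i) \<rho>) \<and>
        (\<forall>i<r. \<forall>j<r. i \<noteq> j \<longrightarrow> \<not> isomorphic_reps G s (U i) \<rho> s (U j) \<rho>))"

section \<open>Induced representations and strong Gelfand pairs\<close>

definition fun_scale :: "(complex \<Rightarrow> 'v \<Rightarrow> 'v) \<Rightarrow> complex \<Rightarrow> ('x \<Rightarrow> 'v) \<Rightarrow> 'x \<Rightarrow> 'v" where
  "fun_scale s c f = (\<lambda>x. s c (f x))"

text \<open>The induced representation of a representation \<open>(V, \<rho>)\<close> of \<open>K\<close> consists of the functions
  \<open>f : G \<rightarrow> V\<close> with \<open>f(kg) = \<rho>(k) f(g)\<close>, on which \<open>G\<close> acts by right translation.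
  Functions on the group are extended by \<open>0\<close> outside the carrier.\<close>

definition ind_space ::
  "('g, 'm) monoid_scheme \<Rightarrow> 'g set \<Rightarrow> 'v::zero set \<Rightarrow> ('g \<Rightarrow> 'v \<Rightarrow> 'v) \<Rightarrow> ('g \<Rightarrow> 'v) set" where
  "ind_space G K V \<rho> =
     {f. (\<forall>g. g \<notin> carrier G \<longrightarrow> f g = 0) \<and> (\<forall>g\<in>carrier G. f g \<in> V) \<and>
         (\<forall>k\<in>K. \<forall>g\<in>carrier G. f (k \<otimes>\<^bsub>G\<^esub> g) = \<rho> k (f g))}"

definition ind_action :: "('g, 'm) monoid_scheme \<Rightarrow> 'g \<Rightarrow> ('g \<Rightarrow> 'v::zero) \<Rightarrow> 'g \<Rightarrow> 'v" where
  "ind_action G g f = (\<lambda>x. if x \<in> carrier G then f (x \<otimes>\<^bsub>G\<^esub> g) else 0)"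

text \<open>Every finite-dimensional complex vector space is isomorphic to a subspace of the space of
  sequences \<open>nat \<Rightarrow> complex\<close>, so it suffices to let \<open>V\<close> range over irreducible representations
  on such subspaces.\<close>

abbreviation seq_scale :: "complex \<Rightarrow> (nat \<Rightarrow> complex) \<Rightarrow> nat \<Rightarrow> complex" where
  "seq_scale \<equiv> fun_scale (*)"

definition strong_Gelfand_pair :: "('g, 'm) monoid_scheme \<Rightarrow> 'g set \<Rightarrow> bool" where
  "strong_Gelfand_pair G K \<longleftrightarrow>
     (\<forall>V \<rho>. irreducible_rep (G\<lparr>carrier := K\<rparr>) seq_scale V \<rho> \<longrightarrow>
        multiplicity_free G (fun_scale seq_scale) (ind_space G K V \<rho>) (ind_action G))"

section \<open>Wreath products with symmetric groups\<close>

text \<open>The permutation action on \<open>F\<^sup>n\<close> moves the entry at position \<open>i\<close> to position \<open>\<sigma> i\<close>,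
  which makes it a left action.\<close>

definition permute_coords :: "nat \<Rightarrow> (nat \<Rightarrow> nat) \<Rightarrow> (nat \<Rightarrow> 'f) \<Rightarrow> nat \<Rightarrow> 'f" where
  "permute_coords n \<sigma> f = (\<lambda>i\<in>{1..n}. f (inv' \<sigma> i))"

definition wreath_sym :: "('f, 'm) monoid_scheme \<Rightarrow> nat \<Rightarrow> ((nat \<Rightarrow> 'f) \<times> (nat \<Rightarrow> nat)) monoid" where
  "wreath_sym F n =
     \<lparr>carrier = carrier (product_group {1..n} (\<lambda>_. F)) \<times> carrier (sym_group n),
      mult = (\<lambda>(f, \<sigma>) (h, \<tau>). (f \<otimes>\<^bsub>product_group {1..n} (\<lambda>_. F)\<^esub> permute_coords n \<sigma> h,
                                \<sigma> \<otimes>\<^bsub>sym_group n\<^esub> \<tau>)),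
      one = (\<one>\<^bsub>product_group {1..n} (\<lambda>_. F)\<^esub>, \<one>\<^bsub>sym_group n\<^esub>)\<rparr>"

definition diag_times_sym :: "('f, 'm) monoid_scheme \<Rightarrow> nat \<Rightarrow> ((nat \<Rightarrow> 'f) \<times> (nat \<Rightarrow> nat)) set" where
  "diag_times_sym F n = {(\<lambda>i\<in>{1..n}. a, \<sigma>) | a \<sigma>. a \<in> carrier F \<and> \<sigma> \<in> carrier (sym_group n)}"

section \<open>Well-definedness\<close>

lemma vector_space_fun_scale:
  assumes "vector_space s" shows "vector_space (fun_scale s)"
proof -
  interpret vector_space s by fact
  show ?thesis
    by unfold_locales (auto simp: fun_scale_def fun_eq_iff scale_right_distrib scale_left_distrib)
qed

lemma vector_space_seq_scale: "vector_space seq_scale"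
  by (rule vector_space_fun_scale) (unfold_locales, auto simp: algebra_simps)

lemma fd_rep_induced:
  fixes s :: "complex \<Rightarrow> 'v::ab_group_add \<Rightarrow> 'v" and G :: "('g, 'm) monoid_scheme"
  assumes G: "group G" "finite (carrier G)" and K: "subgroup K G"
    and V: "fd_rep (G\<lparr>carrier := K\<rparr>) s V \<rho>"
  shows "fd_rep G (fun_scale s) (ind_space G K V \<rho>) (ind_action G)"
proof -
  interpret G: group G by fact
  interpret K: subgroup K G by fact
  interpret V: fd_rep "G\<lparr>carrier := K\<rparr>" s V \<rho> by fact
  interpret F: vector_space "fun_scale s"
    by (rule vector_space_fun_scale) (rule V.vector_space_axioms)
  let ?I = "ind_space G K V \<rho>"
  have lin: "linear_between s V s V (\<rho> k)" if "k \<in> K" for k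
    using V.rho_linear that by simp
  have lin_add: "\<rho> k (v + w) = \<rho> k v + \<rho> k w" if "k \<in> K" "v \<in> V" "w \<in> V" for k v w
    using lin that by (simp add: linear_between_def)
  have lin_scale: "\<rho> k (s c v) = s c (\<rho> k v)" if "k \<in> K" "v \<in> V" for k c v
    using lin that by (simp add: linear_between_def)
  have V0: "0 \<in> V" using V.subspace_V V.subspace_0 by blast
  have lin_0: "\<rho> k 0 = 0" if "k \<in> K" for k
    using lin_scale[OF that V0, of 0] by simp
  have sub: "F.subspace ?I"
    by (rule F.subspaceI)
      (auto simp: ind_space_def fun_scale_def lin_0 lin_add lin_scale V0
         intro: V.subspace_add[OF V.subspace_V] V.subspace_scale[OF V.subspace_V])
  obtain B where B: "finite B" "V.span B = V" using V.finite_dim_V by blast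
  define E where "E = (\<lambda>(g, b). (\<lambda>x. if x = g then b else (0::'v))) ` (carrier G \<times> B)"
  have finE: "finite E" unfolding E_def using G(2) B(1) by auto
  have delta: "(\<lambda>x. if x = g then v else 0) \<in> F.span E" if g: "g \<in> carrier G" and v: "v \<in> V" for g v
  proof -
    have "v \<in> V.span B" using v B by simp
    then show ?thesis
    proof (induction rule: V.span_induct_alt)
      case base
      have "(\<lambda>x. if x = g then 0 else 0) = (0 :: 'g \<Rightarrow> 'v)" by (auto simp: fun_eq_iff)
      then show ?case using F.span_zero[of E] by simp
    next
      case (step c b w)
      have "(\<lambda>x. if x = g then s c b + w else 0)
          = fun_scale s c (\<lambda>x. if x = g then b else 0) + (\<lambda>x. if x = g then w else 0)"
        by (auto simp: fun_eq_iff fun_scale_def)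
      moreover have "(\<lambda>x. if x = g then b else 0) \<in> F.span E"
        using g step(1) by (intro F.span_base) (auto simp: E_def)
      ultimately show ?case using step by (simp add: F.span_add F.span_scale)
    qed
  qed
  have IE: "?I \<subseteq> F.span E"
  proof
    fix f assume f: "f \<in> ?I"
    have "f = (\<Sum>g\<in>carrier G. (\<lambda>x. if x = g then f g else 0))"
    proof
      fix x
      have app: "(\<Sum>g\<in>A. (\<lambda>x. if x = g then f g else 0)) x = (\<Sum>g\<in>A. if x = g then f g else 0)"
        if "finite A" for A using that by (induction A) auto
      show "f x = (\<Sum>g\<in>carrier G. (\<lambda>x. if x = g then f g else 0)) x"
        using f G(2) by (auto simp: app ind_space_def)
    qed
    also have "\<dots> \<in> F.span E"
      using f by (intro F.span_sum delta) (auto simp: ind_space_def)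
    finally show "f \<in> F.span E" .
  qed
  obtain B' where B': "B' \<subseteq> ?I" "F.independent B'" "?I \<subseteq> F.span B'"
    using F.basis_exists[of ?I] by metis
  have "finite B'"
    using F.independent_span_bound[OF finE B'(2)] B'(1) IE by blast
  moreover have "F.span B' = ?I"
    using B' F.span_minimal[OF _ sub] by blast
  ultimately have fin: "\<exists>B. finite B \<and> F.span B = ?I" by blast
  show ?thesis
  proof unfold_locales
    fix g assume g: "g \<in> carrier G"
    show "linear_between (fun_scale s) ?I (fun_scale s) ?I (ind_action G g)"
      using g K.mem_carrier
      by (auto simp: linear_between_def ind_action_def ind_space_def fun_scale_def fun_eq_iff
            G.m_assoc)
  next
    fix f assume "f \<in> ?I"
    then show "ind_action G \<one>\<^bsub>G\<^esub> f = f"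
      by (auto simp: ind_action_def ind_space_def fun_eq_iff)
  next
    fix g h f assume "g \<in> carrier G" "h \<in> carrier G" "f \<in> ?I"
    then show "ind_action G (g \<otimes>\<^bsub>G\<^esub> h) f = ind_action G g (ind_action G h f)"
      by (auto simp: ind_action_def fun_eq_iff G.m_assoc)
  qed (use sub fin in auto)
qed

lemma permutes_inv_mem: "\<sigma> permutes {1..n} \<Longrightarrow> inv' \<sigma> i \<in> {1..n} \<longleftrightarrow> i \<in> {1..n}" for i n :: nat
  by (rule permutes_in_image[OF permutes_inv])

lemma group_wreath_sym:
  assumes "group F" shows "group (wreath_sym F n)"
proof -
  interpret F: group F by fact
  have mem: "\<And>\<sigma> i. \<sigma> permutes {1..n} \<Longrightarrow> i \<in> {1..n} \<Longrightarrow> inv' \<sigma> i \<in> {1..n}"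
    using permutes_inv_mem by blast
  show ?thesis
  proof (rule groupI)
    fix x y assume "x \<in> carrier (wreath_sym F n)" "y \<in> carrier (wreath_sym F n)"
    then show "x \<otimes>\<^bsub>wreath_sym F n\<^esub> y \<in> carrier (wreath_sym F n)"
      using mem by (fastforce simp: wreath_sym_def sym_group_def permute_coords_def permutes_compose PiE_iff)
  next
    show "\<one>\<^bsub>wreath_sym F n\<^esub> \<in> carrier (wreath_sym F n)"
      by (auto simp: wreath_sym_def sym_group_def permutes_id)
  next
    fix x y z
    assume "x \<in> carrier (wreath_sym F n)" "y \<in> carrier (wreath_sym F n)" "z \<in> carrier (wreath_sym F n)"
    then show "x \<otimes>\<^bsub>wreath_sym F n\<^esub> y \<otimes>\<^bsub>wreath_sym F n\<^esub> z
             = x \<otimes>\<^bsub>wreath_sym F n\<^esub> (y \<otimes>\<^bsub>wreath_sym F n\<^esub> z)"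
      using mem
      by (auto simp: wreath_sym_def sym_group_def permute_coords_def fun_eq_iff PiE_iff o_inv_distrib
            permutes_bij F.m_assoc simp del: atLeastAtMost_iff)
  next
    fix x assume "x \<in> carrier (wreath_sym F n)"
    then show "\<one>\<^bsub>wreath_sym F n\<^esub> \<otimes>\<^bsub>wreath_sym F n\<^esub> x = x"
      by (auto simp: wreath_sym_def sym_group_def permute_coords_def fun_eq_iff PiE_iff extensional_def
            simp del: atLeastAtMost_iff)
  next
    fix x assume x: "x \<in> carrier (wreath_sym F n)"
    obtain f \<sigma> where [simp]: "x = (f, \<sigma>)" by force
    have f: "\<And>i. i \<in> {1..n} \<Longrightarrow> f i \<in> carrier F" and \<sigma>: "\<sigma> permutes {1..n}"
      using x by (auto simp: wreath_sym_def sym_group_def)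
    let ?y = "(permute_coords n (inv' \<sigma>) (\<lambda>i. inv\<^bsub>F\<^esub> (f i)), inv' \<sigma>)"
    have mem': "\<And>i. i \<in> {1..n} \<Longrightarrow> \<sigma> i \<in> {1..n}" using \<sigma> permutes_in_image by metis
    have "?y \<in> carrier (wreath_sym F n)"
      using f mem' \<sigma> by (auto simp: wreath_sym_def sym_group_def permute_coords_def permutes_inv
            permutes_inv_inv simp del: atLeastAtMost_iff)
    moreover have "?y \<otimes>\<^bsub>wreath_sym F n\<^esub> x = \<one>\<^bsub>wreath_sym F n\<^esub>"
      using f mem' \<sigma> by (auto simp: wreath_sym_def sym_group_def permute_coords_def fun_eq_iff
            permutes_inv_inv permutes_inverses simp del: atLeastAtMost_iff)
    ultimately show "\<exists>y\<in>carrier (wreath_sym F n). y \<otimes>\<^bsub>wreath_sym F n\<^esub> x = \<one>\<^bsub>wreath_sym F n\<^esub>"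
      by blast
  qed
qed

lemma finite_carrier_wreath_sym:
  assumes "finite (carrier F)" shows "finite (carrier (wreath_sym F n))"
proof -
  have "finite (\<Pi>\<^sub>E i\<in>{1..n}. carrier F)"
    using assms by (intro finite_PiE) auto
  moreover have "finite {p. p permutes {1..n}}"
    by (rule finite_permutations) simp
  ultimately show ?thesis
    by (simp add: wreath_sym_def sym_group_def)
qed

lemma subgroup_diag_times_sym:
  assumes "group F" shows "subgroup (diag_times_sym F n) (wreath_sym F n)"
proof -
  interpret F: group F by fact
  interpret W: group "wreath_sym F n" by (rule group_wreath_sym) fact
  have coords: "permute_coords n \<sigma> (\<lambda>i\<in>{1..n}. a) = (\<lambda>i\<in>{1..n}. a)" if "\<sigma> permutes {1..n}" for \<sigma> and a :: 'a
    unfolding permute_coords_def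
    by (rule restrict_ext) (use permutes_inv_mem[OF that] in \<open>simp only: restrict_apply if_True\<close>)
  have mult: "(\<lambda>i\<in>{1..n}. a, \<sigma>) \<otimes>\<^bsub>wreath_sym F n\<^esub> (\<lambda>i\<in>{1..n}. b, \<tau>)
      = (\<lambda>i\<in>{1..n}. a \<otimes>\<^bsub>F\<^esub> b, \<sigma> \<circ> \<tau>)" if "\<sigma> permutes {1..n}" for a b \<sigma> \<tau>
    using coords[OF that] by (simp add: wreath_sym_def sym_group_def cong: restrict_cong)
  have sub: "diag_times_sym F n \<subseteq> carrier (wreath_sym F n)"
    unfolding diag_times_sym_def wreath_sym_def by auto
  show ?thesis
  proof (rule W.subgroupI)
    show "diag_times_sym F n \<noteq> {}"
      using F.one_closed by (auto simp: diag_times_sym_def sym_group_def intro: permutes_id)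
  next
    fix x assume xd: "x \<in> diag_times_sym F n"
    then obtain a \<sigma> where x: "x = (\<lambda>i\<in>{1..n}. a, \<sigma>)" "a \<in> carrier F" "\<sigma> permutes {1..n}"
      by (auto simp: diag_times_sym_def sym_group_def)
    let ?y = "(\<lambda>i\<in>{1..n}. inv\<^bsub>F\<^esub> a, inv' \<sigma>)"
    have y: "?y \<in> diag_times_sym F n"
      using x by (auto simp: diag_times_sym_def sym_group_def permutes_inv)
    have "?y \<otimes>\<^bsub>wreath_sym F n\<^esub> x = \<one>\<^bsub>wreath_sym F n\<^esub>"
      unfolding x(1) mult[OF permutes_inv[OF x(3)]] using x
      by (auto simp: wreath_sym_def sym_group_def permutes_inv_o)
    then have "inv\<^bsub>wreath_sym F n\<^esub> x = ?y"
      using y xd sub by (intro W.inv_equality) blast+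
    then show "inv\<^bsub>wreath_sym F n\<^esub> x \<in> diag_times_sym F n" using y by simp
  next
    fix x y assume "x \<in> diag_times_sym F n" "y \<in> diag_times_sym F n"
    then obtain a \<sigma> b \<tau> where xy: "x = (\<lambda>i\<in>{1..n}. a, \<sigma>)" "a \<in> carrier F" "\<sigma> permutes {1..n}"
        "y = (\<lambda>i\<in>{1..n}. b, \<tau>)" "b \<in> carrier F" "\<tau> permutes {1..n}"
      by (auto simp: diag_times_sym_def sym_group_def)
    show "x \<otimes>\<^bsub>wreath_sym F n\<^esub> y \<in> diag_times_sym F n"
      unfolding xy(1,4) mult[OF xy(3)] using xy
      by (auto simp: diag_times_sym_def sym_group_def permutes_compose)
  qed (fact sub)
qed

end

(* Convolution by functions on G that are invariant under conjugation by K acts by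
   G-endomorphisms on every representation induced from K. If (G, K) is a strong Gelfand pair, these
   endomorphisms commute by Schur's lemma, and since the induced representations separate functions
   on G, so do the invariant functions themselves. Applied to the indicators of the K-conjugacy
   classes of y and z, this says that y z = z' y' for suitable K-conjugates z' of z and y' of y.

   Over Z/2, the K-class of an element of the wreath product is determined by its cycles, each
   carrying a cyclic 0-1-word. The shortest chiral binary necklace has length 6. Take y a 3-cycle
   with word 111 and z a 4-cycle with word 0101, sharing exactly one point, labelled 1: then y z is
   a 6-cycle with word 001101, whereas z' y' can only produce its mirror image or other words. *)

theory Submission
  imports Defs "HOL-Computational_Algebra.Fundamental_Theorem_Algebra"
begin

section \<open>Linear algebra over a subspace\<close>

lemma linear_betweenD:
  assumes "linear_between s V t W T"
  shows "v \<in> V \<Longrightarrow> T v \<in> W"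
    and "v \<in> V \<Longrightarrow> w \<in> V \<Longrightarrow> T (v + w) = T v + T w"
    and "v \<in> V \<Longrightarrow> T (s c v) = t c (T v)"
  using assms by (auto simp: linear_between_def)

context vector_space
begin

lemma finite_basis_subspace:
  assumes "subspace U" "U \<subseteq> V" "finite B" "span B = V"
  obtains C where "C \<subseteq> U" "independent C" "span C = U" "finite C"
proof -
  obtain C where C: "C \<subseteq> U" "independent C" "U \<subseteq> span C"
    using basis_exists[of U] by metis
  have "finite C"
    using independent_span_bound[OF assms(3) C(2)] C(1) assms by blast
  moreover have "span C = U"
    using C span_minimal[OF C(1) assms(1)] by blast
  ultimately show ?thesis using that C by blast
qed

text \<open>A vector of \<open>V\<close> outside \<open>U\<close> enlarges a basis of
  \<open>U\<close> to a longer independent set. Choosing a subrepresentation of least dimension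
  relies on this.\<close>

lemma dim_strict_mono:
  assumes "subspace U" "subspace V" "U \<subset> V" "finite B" "span B = V"
  shows "dim U < dim V"
proof -
  obtain C where C: "C \<subseteq> U" "independent C" "span C = U" "finite C"
    using finite_basis_subspace[OF assms(1) _ assms(4,5)] assms(3) by blast
  obtain D where D: "D \<subseteq> V" "independent D" "span D = V" "finite D"
    using finite_basis_subspace[OF assms(2) _ assms(4,5)] by blast
  obtain v where v: "v \<in> V" "v \<notin> U" using assms(3) by blast
  have "independent (insert v C)"
    using v C by (intro independent_insertI) auto
  then have "card (insert v C) \<le> card D"
    using independent_span_bound[OF D(4)] C v D assms(3) by blast
  moreover have "v \<notin> C" using v C by blast
  moreover have "dim U = card C" using C by (metis dim_eq_card span_span)
  moreover have "dim V = card D" using D by (metis dim_eq_card span_span)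
  ultimately show ?thesis using C(4) by simp
qed

text \<open>A basis \<open>C\<close> of \<open>U\<close> is extended to a basis \<open>D\<close> of
  \<open>V\<close>, and \<open>p\<close> forgets the coordinates along the added vectors. Maschke's
  averaging starts from this \<open>p\<close>.\<close>

lemma ex_projection:
  assumes "subspace U" "U \<subseteq> V" "finite B" "span B = V"
  obtains p where "p \<in> V \<rightarrow> U" "\<And>u. u \<in> U \<Longrightarrow> p u = u"
    "\<And>v w. v \<in> V \<Longrightarrow> w \<in> V \<Longrightarrow> p (v + w) = p v + p w"
    "\<And>c v. v \<in> V \<Longrightarrow> p (c *s v) = c *s p v"
proof -
  obtain C where C: "C \<subseteq> U" "independent C" "span C = U" "finite C"
    using finite_basis_subspace[OF assms] by blast
  obtain D where D: "C \<subseteq> D" "D \<subseteq> V" "independent D" "V \<subseteq> span D"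
    using maximal_independent_subset_extend[of C V] C assms by blast
  have VD: "v \<in> span D" if "v \<in> V" for v using that D by blast
  let ?p = "\<lambda>v. \<Sum>b\<in>C. representation D v b *s b"
  show ?thesis
  proof (rule that[of ?p])
    show "?p \<in> V \<rightarrow> U"
      using C(1) by (auto intro!: subspace_sum subspace_scale assms(1))
    show "?p u = u" if "u \<in> U" for u
    proof -
      have "representation D u = representation C u"
        using that C D by (intro representation_extend) auto
      then show ?thesis
        using sum_representation_eq[OF C(2) _ C(4) order_refl, of u] that C by simp
    qed
  qed (use D VD in \<open>simp_all add: representation_add representation_scale scale_left_distrib
        sum.distrib scale_sum_right\<close>)
qed

end

section \<open>Eigenvectors over the complex numbers\<close>

lemma funpow_linear_closed:
  assumes "linear_between s V s V T" "v \<in> V"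
  shows "(T ^^ i) v \<in> V"
  by (induction i) (use assms linear_betweenD(1) in auto)

text \<open>The iterates v, T v, T^2 v, ... are linearly dependent, so p(T) v = 0 for some nonzero
  polynomial p. Splitting off linear factors of p one at a time, some stage must meet an
  eigenvector.\<close>

lemma ex_eigenvector:
  fixes s :: "complex \<Rightarrow> 'v::ab_group_add \<Rightarrow> 'v"
  assumes "vector_space s" and V: "module.subspace s V" "finite B" "module.span s B = V" "V \<noteq> {0}"
    and T: "linear_between s V s V T"
  obtains z v where "v \<in> V" "v \<noteq> 0" "T v = s z v"
proof -
  interpret vector_space s by fact
  have V0: "0 \<in> V" using V(1) subspace_0 by blast
  obtain v where v: "v \<in> V" "v \<noteq> 0" using V(4) V0 by blast
  have pw: "(T ^^ i) v \<in> V" for i using funpow_linear_closed[OF T v(1)] .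
  have T0: "T 0 = 0" using linear_betweenD(3)[OF T V0, of 0] by simp
  have T_sum: "T (\<Sum>i\<in>I. x i) = (\<Sum>i\<in>I. T (x i))" if "finite I" "\<And>i. i \<in> I \<Longrightarrow> x i \<in> V"
    for I :: "nat set" and x
    using that by (induction I) (simp_all add: T0 linear_betweenD(2)[OF T] subspace_sum[OF V(1)])
  \<comment> \<open>For \<open>degree p < N\<close> this is p(T) v. Summing up to a bound that does
    not depend on \<open>p\<close> keeps the expression linear in \<open>p\<close>.\<close>
  define ev where "ev N p = (\<Sum>i<N. s (coeff p i) ((T ^^ i) v))" for N and p :: "complex poly"
  have ev_V: "ev N p \<in> V" for N p
    unfolding ev_def by (intro subspace_sum subspace_scale V(1) pw)
  have ev_cons: "ev (Suc N) (pCons 0 q) = T (ev N q)" for N q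
  proof -
    have "ev (Suc N) (pCons 0 q) = (\<Sum>i<N. s (coeff q i) ((T ^^ Suc i) v))"
      unfolding ev_def by (subst sum.lessThan_Suc_shift) simp
    also have "\<dots> = (\<Sum>i<N. T (s (coeff q i) ((T ^^ i) v)))"
      by (simp add: linear_betweenD(3)[OF T] pw)
    also have "\<dots> = T (ev N q)"
      unfolding ev_def by (rule T_sum[symmetric]) (auto intro: subspace_scale V(1) pw)
    finally show ?thesis .
  qed
  have ev_Suc: "ev (Suc N) q = ev N q" if "coeff q N = 0" for N q
    using that by (simp add: ev_def)
  have eig: "\<exists>z u. u \<in> V \<and> u \<noteq> 0 \<and> T u = s z u"
    if "p \<noteq> 0" "degree p < N" "ev N p = 0" for N p
    using that
  proof (induction N arbitrary: p)
    case (Suc N)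
    show ?case
    proof (cases "degree p = 0")
      case True
      then obtain a where a: "p = [:a:]" by (metis degree_eq_zeroE)
      have "(\<Sum>i<Suc N. s (coeff p i) ((T ^^ i) v)) = s a v"
        unfolding a by (subst sum.lessThan_Suc_shift) simp
      then show ?thesis using Suc.prems v a by (simp add: ev_def)
    next
      case False
      then obtain z where "poly p z = 0"
        using fundamental_theorem_of_algebra[of p] by (auto simp: constant_degree)
      then obtain q where q: "p = [:- z, 1:] * q" by (metis poly_eq_0_iff_dvd dvdE)
      then have q0: "q \<noteq> 0" using Suc.prems(1) by auto
      have "degree p = Suc (degree q)" unfolding q using q0 by (subst degree_mult_eq) auto
      then have dq: "degree q < N" using Suc.prems(2) by simp
      have "ev (Suc N) p = ev (Suc N) (pCons 0 q) + s (- z) (ev (Suc N) q)"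
        unfolding q ev_def
        by (simp only: scale_sum_right sum.distrib[symmetric] scale_scale scale_left_distrib[symmetric])
          (simp add: algebra_simps)
      also have "\<dots> = T (ev N q) - s z (ev N q)"
        using dq by (simp add: ev_cons ev_Suc coeff_eq_0)
      finally have "T (ev N q) = s z (ev N q)" using Suc.prems(3) by simp
      \<comment> \<open>Here (T - z) q(T) v = 0: either q(T) v is nonzero and is an eigenvector for
        \<open>z\<close>, or \<open>q\<close> also annihilates \<open>v\<close> and has smaller
        degree.\<close>
      then show ?thesis using Suc.IH[OF q0 dq] ev_V by blast
    qed
  qed (simp)
  \<comment> \<open>One more than the size of a spanning set, so that \<open>N\<close> distinct
    iterates cannot be independent.\<close>
  define N where "N = Suc (card B)"
  have "\<exists>p. p \<noteq> 0 \<and> degree p < N \<and> ev N p = 0"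
  \<comment> \<open>Independence is a property of the set of iterates and does not see repetitions.
    A repetition directly yields the polynomial X^i - X^j.\<close>
  proof (cases "inj_on (\<lambda>i. (T ^^ i) v) {..<N}")
    case False
    then obtain i j where ij: "i < N" "j < N" "i \<noteq> j" "(T ^^ i) v = (T ^^ j) v"
      by (auto simp: inj_on_def)
    let ?p = "monom 1 i - monom 1 j :: complex poly"
    have "coeff ?p i = 1" using ij by simp
    then have "?p \<noteq> 0" by (metis coeff_0 zero_neq_one)
    moreover have "degree ?p < N"
      using ij by (intro degree_diff_less) (auto simp: degree_monom_eq)
    moreover have "ev N ?p = 0"
    proof -
      have "ev N ?p = (\<Sum>k<N. if k = i then (T ^^ i) v else 0) - (\<Sum>k<N. if k = j then (T ^^ j) v else 0)"
        unfolding ev_def sum_subtractf[symmetric] by (rule sum.cong) (auto simp: scale_left_diff_distrib)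
      then show ?thesis using ij by simp
    qed
    ultimately show ?thesis by blast
  next
    case True
    let ?S = "(\<lambda>i. (T ^^ i) v) ` {..<N}"
    have "\<not> independent ?S"
    proof
      assume "independent ?S"
      then have "card ?S \<le> card B"
        using independent_span_bound[OF V(2)] V(3) pw by blast
      then show False using card_image[OF True] by (simp add: N_def)
    qed
    then obtain u where u: "(\<Sum>w\<in>?S. s (u w) w) = 0" "\<exists>w\<in>?S. u w \<noteq> 0"
      by (subst (asm) dependent_finite) auto
    define p where "p = (\<Sum>i<N. monom (u ((T ^^ i) v)) i)"
    have cp: "coeff p i = (if i < N then u ((T ^^ i) v) else 0)" for i
      by (simp add: p_def coeff_sum)
    have "p \<noteq> 0"
    proof -
      obtain i where "i < N" "u ((T ^^ i) v) \<noteq> 0" using u(2) by auto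
      then have "coeff p i \<noteq> 0" by (simp add: cp)
      then show ?thesis by auto
    qed
    moreover have "degree p < N"
      using degree_le[of "card B" p] cp by (simp add: N_def)
    moreover have "ev N p = 0"
      using u(1) by (simp add: ev_def cp sum.reindex[OF True])
    ultimately show ?thesis by blast
  qed
  then show ?thesis using eig that by metis
qed

section \<open>Maschke and Schur\<close>

lemma linear_between_subset:
  assumes "linear_between s V t W T" "U \<subseteq> V" "X \<subseteq> W" "T ` U \<subseteq> X"
  shows "linear_between s U t X T"
  using assms by (fastforce simp: linear_between_def image_subset_iff)

context fd_rep
begin

lemma rho_closed: "g \<in> carrier G \<Longrightarrow> v \<in> V \<Longrightarrow> \<rho> g v \<in> V"
  and rho_add: "g \<in> carrier G \<Longrightarrow> v \<in> V \<Longrightarrow> w \<in> V \<Longrightarrow> \<rho> g (v + w) = \<rho> g v + \<rho> g w"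
  and rho_scale: "g \<in> carrier G \<Longrightarrow> v \<in> V \<Longrightarrow> \<rho> g (scale c v) = scale c (\<rho> g v)"
  using linear_betweenD[OF rho_linear] by blast+

lemma zero_mem: "0 \<in> V"
  using subspace_V subspace_0 by blast

lemma rho_zero: "g \<in> carrier G \<Longrightarrow> \<rho> g 0 = 0"
  using rho_scale[OF _ zero_mem, of g 0] by simp

lemma rho_sum:
  assumes "g \<in> carrier G" "\<And>i. i \<in> I \<Longrightarrow> x i \<in> V"
  shows "\<rho> g (\<Sum>i\<in>I. x i) = (\<Sum>i\<in>I. \<rho> g (x i))"
  using assms(2)
proof (induction I rule: infinite_finite_induct)
  case (insert i I)
  then show ?case
    using assms(1) by (simp add: rho_add subspace_sum[OF subspace_V])
qed (simp_all add: assms(1) rho_zero)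

lemma rho_inv_cancel:
  assumes "g \<in> carrier G" "v \<in> V" shows "\<rho> g (\<rho> (inv g) v) = v"
  using rho_mult[of g "inv g" v] rho_one assms by simp

lemma subrepI:
  assumes "subspace U" "U \<subseteq> V" "\<And>g u. g \<in> carrier G \<Longrightarrow> u \<in> U \<Longrightarrow> \<rho> g u \<in> U"
  shows "fd_rep G scale U \<rho>"
proof unfold_locales
  obtain B where "finite B" "span B = V" using finite_dim_V by blast
  then obtain C where "span C = U" "finite C"
    using finite_basis_subspace[OF assms(1,2)] by metis
  then show "\<exists>B. finite B \<and> span B = U" by blast
  show "linear_between scale U scale U (\<rho> g)" if "g \<in> carrier G" for g
    using assms(2,3) that by (intro linear_between_subset[OF rho_linear[OF that]]) auto
qed (use assms rho_one rho_mult in auto)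

text \<open>Maschke's theorem: averaging a linear projection onto \<open>U\<close> over the group
  makes it equivariant, and its kernel \<open>W\<close> is an invariant complement. It is proper
  because \<open>U\<close> is nonzero.\<close>

lemma complement:
  assumes U: "fd_rep G scale U \<rho>" "U \<subseteq> V" "U \<noteq> {0}" and fin: "finite (carrier G)"
  obtains W where "fd_rep G scale W \<rho>" "W \<subset> V"
    "\<And>v. v \<in> V \<Longrightarrow> \<exists>u\<in>U. v - u \<in> W"
proof -
  interpret U: fd_rep G scale U \<rho> by fact
  obtain B where "finite B" "span B = V" using finite_dim_V by blast
  then obtain p where p: "p \<in> V \<rightarrow> U" and pU: "\<And>u. u \<in> U \<Longrightarrow> p u = u"
    and p_add: "\<And>v w. v \<in> V \<Longrightarrow> w \<in> V \<Longrightarrow> p (v + w) = p v + p w"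
    and p_scale: "\<And>c v. v \<in> V \<Longrightarrow> p (scale c v) = scale c (p v)"
    using ex_projection[OF U.subspace_V U(2)] by metis
  \<comment> \<open>The sum is not divided by the group order, so on \<open>U\<close> it is
    multiplication by \<open>?N\<close> instead of the identity; the \<open>U\<close>-part of
    \<open>v\<close> is P v / \<open>?N\<close>.\<close>
  define P where "P v = (\<Sum>g\<in>carrier G. \<rho> g (p (\<rho> (inv g) v)))" for v
  let ?N = "of_nat (card (carrier G)) :: complex"
  have N: "?N \<noteq> 0" using fin by (metis card_0_eq empty_iff of_nat_eq_0_iff one_closed)
  have pV: "p v \<in> U" if "v \<in> V" for v using p that by blast
  have P_U: "P v \<in> U" if "v \<in> V" for v
    unfolding P_def using that by (intro subspace_sum U.subspace_V U.rho_closed pV rho_closed) auto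
  have P_id: "P u = scale ?N u" if "u \<in> U" for u
  proof -
    have "P u = (\<Sum>g\<in>carrier G. u)"
      unfolding P_def using that U(2)
      by (intro sum.cong) (auto simp: pU U.rho_closed U.rho_inv_cancel)
    then show ?thesis by (simp add: sum_constant_scale)
  qed
  have pV': "p v \<in> V" if "v \<in> V" for v using pV[OF that] U(2) by blast
  have P_add: "P (v + w) = P v + P w" if "v \<in> V" "w \<in> V" for v w
    unfolding P_def sum.distrib[symmetric] using that
    by (intro sum.cong) (simp_all add: rho_add rho_closed p_add pV')
  have P_scale: "P (scale c v) = scale c (P v)" if "v \<in> V" for c v
    unfolding P_def scale_sum_right using that
    by (intro sum.cong) (simp_all add: rho_scale rho_closed p_scale pV')
  have P_rho: "P (\<rho> h v) = \<rho> h (P v)" if h: "h \<in> carrier G" and v: "v \<in> V" for h v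
  proof -
    \<comment> \<open>Replacing g by h g in the sum lets one factor \<open>h\<close> come out in
      front and cancels the inner one.\<close>
    have "P (\<rho> h v) = (\<Sum>g\<in>carrier G. \<rho> (h \<otimes> g) (p (\<rho> (inv (h \<otimes> g)) (\<rho> h v))))"
      unfolding P_def
      by (rule sum.reindex_bij_witness[of _ "\<lambda>g. h \<otimes> g" "\<lambda>g. inv h \<otimes> g"])
        (use h in \<open>auto simp: m_assoc[symmetric]\<close>)
    also have "\<dots> = (\<Sum>g\<in>carrier G. \<rho> h (\<rho> g (p (\<rho> (inv g) v))))"
    proof (intro sum.cong refl)
      fix g assume g: "g \<in> carrier G"
      have "\<rho> (inv (h \<otimes> g)) (\<rho> h v) = \<rho> (inv (h \<otimes> g) \<otimes> h) v"
        using g h v by (simp add: rho_mult)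
      also have "inv (h \<otimes> g) \<otimes> h = inv g"
        using g h by (simp add: inv_mult_group m_assoc)
      finally show "\<rho> (h \<otimes> g) (p (\<rho> (inv (h \<otimes> g)) (\<rho> h v))) = \<rho> h (\<rho> g (p (\<rho> (inv g) v)))"
        using g h v by (simp add: rho_mult pV' rho_closed)
    qed
    also have "\<dots> = \<rho> h (P v)"
      unfolding P_def using h v by (intro rho_sum[symmetric]) (auto intro!: rho_closed pV')
    finally show ?thesis .
  qed
  define W where "W = {v \<in> V. P v = 0}"
  have P0: "P 0 = 0" using P_scale[OF zero_mem, of 0] by simp
  have "subspace W"
    by (rule subspaceI)
      (auto simp: W_def zero_mem P0 P_add P_scale subspace_add[OF subspace_V] subspace_scale[OF subspace_V])
  then have "fd_rep G scale W \<rho>"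
    by (rule subrepI) (auto simp: W_def rho_closed P_rho rho_zero)
  moreover have "W \<subset> V"
  proof -
    obtain u where u: "u \<in> U" "u \<noteq> 0" using U(3) U.zero_mem by blast
    then have "u \<notin> W" using P_id N by (simp add: W_def)
    then show ?thesis using u U(2) by (auto simp: W_def)
  qed
  moreover have "\<exists>u\<in>U. v - u \<in> W" if v: "v \<in> V" for v
  proof -
    let ?u = "scale (inverse ?N) (P v)"
    have u: "?u \<in> U" using P_U[OF v] subspace_scale[OF U.subspace_V] by blast
    then have uV: "?u \<in> V" using U(2) by blast
    have "P (v - ?u) + P ?u = P v"
      using P_add[OF subspace_diff[OF subspace_V v uV] uV] by simp
    then have "P (v - ?u) = 0" using P_id[OF u] N by simp
    then show ?thesis using u uV v by (auto simp: W_def subspace_diff[OF subspace_V] intro!: bexI[of _ ?u])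
  qed
  ultimately show ?thesis using that by blast
qed

end

text \<open>Schur's lemma, first half: an eigenspace of \<open>T\<close> is a nonzero
  subrepresentation, hence everything.\<close>

lemma schur_scalar:
  assumes "irreducible_rep G s V \<rho>" and T: "linear_between s V s V T"
    and eq: "\<And>g v. g \<in> carrier G \<Longrightarrow> v \<in> V \<Longrightarrow> T (\<rho> g v) = \<rho> g (T v)"
  obtains z where "\<And>v. v \<in> V \<Longrightarrow> T v = s z v"
proof -
  interpret fd_rep G s V \<rho> using assms(1) by (simp add: irreducible_rep_def)
  obtain B where B: "finite B" "span B = V" using finite_dim_V by blast
  have "V \<noteq> {0}" using assms(1) by (simp add: irreducible_rep_def)
  then obtain z v where v: "v \<in> V" "v \<noteq> 0" "T v = s z v"
    using ex_eigenvector[OF vector_space_axioms subspace_V B _ T] by metis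
  define E where "E = {v \<in> V. T v = s z v}"
  have T0: "T 0 = 0" using linear_betweenD(3)[OF T zero_mem, of 0] by simp
  have "subspace E"
    by (rule subspaceI)
      (auto simp: E_def zero_mem T0 linear_betweenD[OF T] subspace_add[OF subspace_V]
        subspace_scale[OF subspace_V] scale_right_distrib scale_left_commute)
  then have "fd_rep G s E \<rho>"
    by (rule subrepI) (auto simp: E_def rho_closed eq rho_scale)
  moreover have "E \<subseteq> V" "E \<noteq> {0}" using v by (auto simp: E_def)
  ultimately have "E = V" using assms(1) by (auto simp: irreducible_rep_def)
  then show ?thesis using that by (auto simp: E_def)
qed

text \<open>Schur's lemma, second half: kernel and image of \<open>T\<close> are subrepresentations,
  and as \<open>T\<close> is nonzero, the kernel vanishes and the image is all of
  \<open>W\<close>.\<close>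

lemma schur_zero_or_iso:
  assumes "irreducible_rep G s V \<rho>" "irreducible_rep G t W \<tau>" and T: "linear_between s V t W T"
    and eq: "\<And>g v. g \<in> carrier G \<Longrightarrow> v \<in> V \<Longrightarrow> T (\<rho> g v) = \<tau> g (T v)"
    and v: "v \<in> V" "T v \<noteq> 0"
  shows "isomorphic_reps G s V \<rho> t W \<tau>"
proof -
  interpret V: fd_rep G s V \<rho> using assms(1) by (simp add: irreducible_rep_def)
  interpret W: fd_rep G t W \<tau> using assms(2) by (simp add: irreducible_rep_def)
  note T_lin = linear_betweenD[OF T]
  have T0: "T 0 = 0" using T_lin(3)[OF V.zero_mem, of 0] by simp
  define K where "K = {v \<in> V. T v = 0}"
  have "V.subspace K"
    by (rule V.subspaceI)
      (auto simp: K_def V.zero_mem T0 T_lin V.subspace_add[OF V.subspace_V]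
        V.subspace_scale[OF V.subspace_V])
  then have "fd_rep G s K \<rho>"
    by (rule V.subrepI) (auto simp: K_def V.rho_closed eq W.rho_zero)
  moreover have "K \<subseteq> V" "K \<noteq> V" using v by (auto simp: K_def)
  ultimately have K: "K = {0}" using assms(1) by (auto simp: irreducible_rep_def)
  have "inj_on T V"
  proof (rule inj_onI)
    fix x y assume xy: "x \<in> V" "y \<in> V" "T x = T y"
    have d: "x - y \<in> V" using xy V.subspace_diff[OF V.subspace_V] by blast
    have "T (x - y) + T y = T x" using T_lin(2)[OF d xy(2)] by simp
    then have "x - y \<in> K" using d xy by (simp add: K_def)
    then show "x = y" using K by simp
  qed
  moreover have "T ` V = W"
  proof -
    have "W.subspace (T ` V)"
    proof (rule W.subspaceI)
      show "0 \<in> T ` V" using T0 V.zero_mem by force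
      show "x + y \<in> T ` V" if "x \<in> T ` V" "y \<in> T ` V" for x y
        using that V.subspace_add[OF V.subspace_V] T_lin(2) by (metis (no_types, lifting) imageE imageI)
      show "t c x \<in> T ` V" if "x \<in> T ` V" for c x
        using that V.subspace_scale[OF V.subspace_V] T_lin(3) by (metis (no_types, lifting) imageE imageI)
    qed
    moreover have TW: "T ` V \<subseteq> W" using T_lin(1) by blast
    ultimately have "fd_rep G t (T ` V) \<tau>"
      by (rule W.subrepI) (auto simp: eq[symmetric] V.rho_closed)
    moreover have "T ` V \<noteq> {0}" using v by blast
    ultimately show ?thesis using TW assms(2) unfolding irreducible_rep_def by blast
  qed
  ultimately show ?thesis
    using T eq by (auto simp: isomorphic_reps_def bij_betw_def)
qed

text \<open>Without repeated constituents, Schur's lemma makes every equivariant endomorphism a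
  scalar on each \<open>U i\<close>, and scalars commute.\<close>

lemma multiplicity_free_commute:
  assumes mf: "multiplicity_free G s V \<rho>" and rep: "fd_rep G s V \<rho>"
    and A: "linear_between s V s V A" "\<And>g v. g \<in> carrier G \<Longrightarrow> v \<in> V \<Longrightarrow> A (\<rho> g v) = \<rho> g (A v)"
    and B: "linear_between s V s V B" "\<And>g v. g \<in> carrier G \<Longrightarrow> v \<in> V \<Longrightarrow> B (\<rho> g v) = \<rho> g (B v)"
    and v: "v \<in> V"
  shows "A (B v) = B (A v)"
proof -
  interpret V: fd_rep G s V \<rho> by fact
  obtain r U where sum: "internal_direct_sum V {..<r::nat} U"
    and irr: "\<And>i. i < r \<Longrightarrow> irreducible_rep G s (U i) \<rho>"
    and noniso: "\<And>i j. i < r \<Longrightarrow> j < r \<Longrightarrow> i \<noteq> j \<Longrightarrow> \<not> isomorphic_reps G s (U i) \<rho> s (U j) \<rho>"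
    using mf by (auto simp: multiplicity_free_def)
  have repU: "fd_rep G s (U i) \<rho>" if "i < r" for i
    using irr[OF that] by (simp add: irreducible_rep_def)
  have UV: "x \<in> V" if "i < r" "x \<in> U i" for i x
    using sum that by (auto simp: internal_direct_sum_def)
  have ex: "\<exists>!u. u \<in> (\<Pi>\<^sub>E i\<in>{..<r}. U i) \<and> (\<Sum>i<r. u i) = v" if "v \<in> V" for v
    using sum that by (auto simp: internal_direct_sum_def)
  \<comment> \<open>\<open>c v i\<close> is the component of \<open>v\<close> in \<open>U i\<close>.
    Uniqueness of the decomposition is stated for extensional families, so other families are
    compared with \<open>c v\<close> after restriction to \<open>{..<r}\<close>.\<close>
  define c where "c v = (THE u. u \<in> (\<Pi>\<^sub>E i\<in>{..<r}. U i) \<and> (\<Sum>i<r. u i) = v)" for v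
  have c: "c v \<in> (\<Pi>\<^sub>E i\<in>{..<r}. U i)" "(\<Sum>i<r. c v i) = v" if "v \<in> V" for v
    using theI'[OF ex[OF that]] by (simp_all add: c_def)
  have cU: "c v i \<in> U i" if "v \<in> V" "i < r" for v i
    using c(1)[OF that(1)] that(2) by auto
  have c_eq: "c v i = u i" if "v \<in> V" "\<And>i. i < r \<Longrightarrow> u i \<in> U i" "(\<Sum>i<r. u i) = v" "i < r" for u v i
  proof -
    have "restrict u {..<r} \<in> (\<Pi>\<^sub>E i\<in>{..<r}. U i) \<and> (\<Sum>i<r. restrict u {..<r} i) = v"
      using that(2,3) by auto
    then have "c v = restrict u {..<r}" using ex[OF that(1)] c[OF that(1)] by blast
    then show ?thesis using that(4) by simp
  qed
  have c_add: "c (v + w) i = c v i + c w i" if "v \<in> V" "w \<in> V" "i < r" for v w i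
  proof (rule c_eq)
    show "c v i + c w i \<in> U i" if "i < r" for i
      using cU \<open>v \<in> V\<close> \<open>w \<in> V\<close> that V.subspace_add[OF fd_rep.subspace_V[OF repU[OF that]]] by blast
  qed (use that in \<open>auto simp: sum.distrib c V.subspace_add[OF V.subspace_V]\<close>)
  have c_scale: "c (s a v) i = s a (c v i)" if "v \<in> V" "i < r" for v a i
  proof (rule c_eq)
    show "s a (c v i) \<in> U i" if "i < r" for i
      using cU \<open>v \<in> V\<close> that V.subspace_scale[OF fd_rep.subspace_V[OF repU[OF that]]] by blast
  qed (use that in \<open>auto simp: V.scale_sum_right[symmetric] c V.subspace_scale[OF V.subspace_V]\<close>)
  have c_rho: "c (\<rho> g v) i = \<rho> g (c v i)" if "v \<in> V" "i < r" "g \<in> carrier G" for v g i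
  proof (rule c_eq)
    show "\<rho> g (c v i) \<in> U i" if "i < r" for i
      using fd_rep.rho_closed[OF repU[OF that] \<open>g \<in> carrier G\<close>] cU \<open>v \<in> V\<close> that by blast
    show "(\<Sum>i<r. \<rho> g (c v i)) = \<rho> g v"
      using V.rho_sum[of g "{..<r}" "c v"] that UV cU c(2)[OF that(1)] by auto
  qed (use that V.rho_closed in auto)
  \<comment> \<open>The block of \<open>T\<close> from \<open>U i\<close> to \<open>U j\<close> is
    zero for distinct i and j, since these constituents are not isomorphic; the diagonal block is a
    scalar.\<close>
  have scalar: "\<exists>z. \<forall>x\<in>U i. T x = s z x"
    if i: "i < r" and T: "linear_between s V s V T"
      and eq: "\<And>g v. g \<in> carrier G \<Longrightarrow> v \<in> V \<Longrightarrow> T (\<rho> g v) = \<rho> g (T v)" for i T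
  proof -
    have TV: "T x \<in> V" if "x \<in> U i" for x using that UV[OF i] linear_betweenD(1)[OF T] by blast
    have lin: "linear_between s (U i) s (U j) (\<lambda>x. c (T x) j)" if j: "j < r" for j
      using UV[OF i] TV cU[OF _ j] j
      by (auto simp: linear_between_def linear_betweenD(2,3)[OF T] c_add c_scale)
    have comm: "c (T (\<rho> g x)) j = \<rho> g (c (T x) j)" if "j < r" "g \<in> carrier G" "x \<in> U i" for j g x
      using that UV[OF i] TV by (simp add: eq c_rho)
    have off: "c (T x) j = 0" if "j < r" "j \<noteq> i" "x \<in> U i" for j x
      using schur_zero_or_iso[OF irr[OF i] irr[OF that(1)] lin[OF that(1)]] comm noniso[OF i that(1)] that
      by blast
    obtain z where z: "\<And>x. x \<in> U i \<Longrightarrow> c (T x) i = s z x"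
      using schur_scalar[OF irr[OF i] lin[OF i]] comm[OF i] by blast
    have "T x = s z x" if "x \<in> U i" for x
    proof -
      have "T x = (\<Sum>j<r. c (T x) j)" using c(2)[OF TV[OF that]] by simp
      also have "\<dots> = (\<Sum>j<r. if j = i then s z x else 0)"
        using off that z by (intro sum.cong) auto
      finally show ?thesis using i by simp
    qed
    then show ?thesis by blast
  qed
  have T_sum: "T v = (\<Sum>i<r. T (c v i))" if T: "linear_between s V s V T" and v: "v \<in> V" for T v
  proof -
    have "T (\<Sum>i\<in>I. x i) = (\<Sum>i\<in>I. T (x i))" if "finite I" "\<And>i. i \<in> I \<Longrightarrow> x i \<in> V"
      for I :: "nat set" and x
      using that
    proof (induction I)
      case empty
      then show ?case using linear_betweenD(3)[OF T V.zero_mem, of 0] by simp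
    qed (simp add: linear_betweenD(2)[OF T] V.subspace_sum[OF V.subspace_V])
    from this[of "{..<r}" "c v"] show ?thesis using c(2)[OF v] cU[OF v] UV by simp
  qed
  obtain za where za: "\<And>i x. i < r \<Longrightarrow> x \<in> U i \<Longrightarrow> A x = s (za i) x"
    using scalar[OF _ A] by metis
  obtain zb where zb: "\<And>i x. i < r \<Longrightarrow> x \<in> U i \<Longrightarrow> B x = s (zb i) x"
    using scalar[OF _ B] by metis
  have AB: "A (B x) = B (A x)" if "i < r" "x \<in> U i" for i x
    using za zb that UV linear_betweenD(3)[OF A(1)] linear_betweenD(3)[OF B(1)]
    by (simp add: V.scale_left_commute)
  have comp: "linear_between s V s V (\<lambda>x. S (T x))"
    if "linear_between s V s V S" "linear_between s V s V T" for S T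
    using that by (auto simp: linear_between_def Pi_iff)
  have "A (B v) = (\<Sum>i<r. A (B (c v i)))" using T_sum[OF comp[OF A(1) B(1)] v] .
  also have "\<dots> = (\<Sum>i<r. B (A (c v i)))" by (intro sum.cong) (auto intro: AB cU v)
  also have "\<dots> = B (A v)" using T_sum[OF comp[OF B(1) A(1)] v] by simp
  finally show ?thesis .
qed

section \<open>Irreducible representations detect functions on a finite group\<close>

lemma sum_fun_apply': "(\<Sum>i\<in>I. f i) x = (\<Sum>i\<in>I. f i x)"
  for f :: "'i \<Rightarrow> 'a \<Rightarrow> 'b::comm_monoid_add"
  by (induction I rule: infinite_finite_induct) auto

lemma (in group) inv_mult_cancel:
  assumes "x \<in> carrier G" "y \<in> carrier G"
  shows "inv x \<otimes> (x \<otimes> y) = y" "x \<otimes> (inv x \<otimes> y) = y"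
  using assms by (simp_all add: m_assoc[symmetric])

text \<open>\<open>d\<close> acts as an element of the group algebra. A subrepresentation of least
  dimension on which it does not vanish is irreducible: otherwise it would be a sum of two proper
  subrepresentations, on both of which the element vanishes by minimality.\<close>

lemma (in fd_rep) ex_irreducible_subrep:
  assumes fin: "finite (carrier G)"
    and "v \<in> V" "(\<Sum>k\<in>carrier G. scale (d k) (\<rho> k v)) \<noteq> 0"
  obtains U u where "irreducible_rep G scale U \<rho>" "u \<in> U"
    "(\<Sum>k\<in>carrier G. scale (d k) (\<rho> k u)) \<noteq> 0"
proof -
  define D where "D v = (\<Sum>k\<in>carrier G. scale (d k) (\<rho> k v))" for v
  define Q where "Q U \<longleftrightarrow> fd_rep G scale U \<rho> \<and> U \<subseteq> V \<and> (\<exists>u\<in>U. D u \<noteq> 0)" for U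
  have D_add: "D (u + w) = D u + D w" if "u \<in> V" "w \<in> V" for u w
    using that by (simp add: D_def rho_add scale_right_distrib sum.distrib)
  have "Q V" using assms(2,3) fd_rep_axioms by (auto simp: Q_def D_def)
  then obtain U where QU: "Q U" and min: "\<And>U'. Q U' \<Longrightarrow> dim U \<le> dim U'"
    using ex_has_least_nat[of Q V dim] by blast
  interpret U: fd_rep G scale U \<rho> using QU by (simp add: Q_def)
  have UV: "U \<subseteq> V" using QU by (simp add: Q_def)
  obtain u where u: "u \<in> U" "D u \<noteq> 0" using QU by (auto simp: Q_def)
  obtain B where B: "finite B" "span B = U" using U.finite_dim_V by blast
  have small: "\<forall>x\<in>X. D x = 0" if "X \<subset> U" "fd_rep G scale X \<rho>" for X
  proof (rule ccontr)
    assume "\<not> ?thesis"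
    then have "Q X" using that UV by (auto simp: Q_def)
    then have "dim U \<le> dim X" by (rule min)
    moreover have "dim X < dim U"
      using dim_strict_mono[OF fd_rep.subspace_V[OF that(2)] U.subspace_V that(1) B] .
    ultimately show False by simp
  qed
  have "X = {0} \<or> X = U" if X: "X \<subseteq> U" "fd_rep G scale X \<rho>" for X
  proof (rule ccontr)
    assume "\<not> ?thesis"
    then have X': "X \<noteq> {0}" "X \<subset> U" using X by auto
    obtain W where W: "fd_rep G scale W \<rho>" "W \<subset> U" "\<And>v. v \<in> U \<Longrightarrow> \<exists>x\<in>X. v - x \<in> W"
      using U.complement[OF X(2,1) X'(1) fin] by blast
    obtain x where x: "x \<in> X" "u - x \<in> W" using W(3)[OF u(1)] by blast
    have "D u = D x + D (u - x)"
      using D_add[of x "u - x"] x X W(2) UV by auto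
    then show False using small[OF X'(2) X(2)] small[OF W(2,1)] x u(2) by simp
  qed
  moreover have "U \<noteq> {0}"
    using u by (auto simp: D_def rho_zero)
  ultimately have "irreducible_rep G scale U \<rho>"
    using U.fd_rep_axioms by (auto simp: irreducible_rep_def)
  then show ?thesis using that u by (simp add: D_def)
qed

text \<open>Cut an irreducible constituent out of the regular representation, whose vectors are
  encoded as sequences via an enumeration \<open>e\<close> of the group.\<close>

lemma irreducible_reps_separate:
  fixes d :: "'g \<Rightarrow> complex"
  assumes "group G" and fin: "finite (carrier G)" and d: "d \<one>\<^bsub>G\<^esub> \<noteq> 0"
  obtains V \<rho> v where "irreducible_rep G seq_scale V \<rho>" "v \<in> V"
    "(\<Sum>k\<in>carrier G. seq_scale (d k) (\<rho> k v)) \<noteq> 0"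
proof -
  interpret group G by fact
  interpret vector_space seq_scale by (rule vector_space_seq_scale)
  define N where "N = card (carrier G)"
  obtain e where e: "bij_betw e (carrier G) {0..<N}"
    using ex_bij_betw_finite_nat[OF fin] N_def by blast
  define e' where "e' = inv_into (carrier G) e"
  have e_lt: "e x < N" and e'e: "e' (e x) = x" if "x \<in> carrier G" for x
    using e that bij_betw_inv_into_left[OF e that] by (auto simp: e'_def bij_betw_def)
  have e'_in: "e' i \<in> carrier G" and ee': "e (e' i) = i" if "i < N" for i
    using e that bij_betw_inv_into_right[OF e, of i] bij_betw_inv_into[OF e]
    by (auto simp: e'_def bij_betw_def)
  define V where "V = {f :: nat \<Rightarrow> complex. \<forall>i\<ge>N. f i = 0}"
  \<comment> \<open>Right translation of functions on the group, transported along
    \<open>e\<close>.\<close>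
  define \<rho> where "\<rho> k f = (\<lambda>i. if i < N then f (e (e' i \<otimes>\<^bsub>G\<^esub> k)) else 0)"
    for k and f :: "nat \<Rightarrow> complex"
  have "subspace V"
    by (rule subspaceI) (auto simp: V_def fun_scale_def)
  moreover have "\<exists>B. finite B \<and> span B = V"
  proof (intro exI conjI)
    let ?B = "(\<lambda>j i. if i = j then 1 else 0 :: complex) ` {..<N}"
    have "f \<in> span ?B" if "f \<in> V" for f
    proof -
      have "f = (\<Sum>j<N. seq_scale (f j) (\<lambda>i. if i = j then 1 else 0))"
      proof
        fix i
        have "(\<Sum>j<N. seq_scale (f j) (\<lambda>i. if i = j then 1 else 0)) i = (\<Sum>j<N. if i = j then f j else 0)"
          unfolding sum_fun_apply' by (intro sum.cong) (auto simp: fun_scale_def)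
        then show "f i = (\<Sum>j<N. seq_scale (f j) (\<lambda>i. if i = j then 1 else 0)) i"
          using that by (auto simp: V_def)
      qed
      also have "\<dots> \<in> span ?B"
        by (intro span_sum span_scale span_base) auto
      finally show ?thesis .
    qed
    moreover have "span ?B \<subseteq> V"
      by (rule span_minimal) (auto simp: V_def \<open>subspace V\<close>[unfolded V_def])
    ultimately show "span ?B = V" by blast
  qed simp
  ultimately have "fd_rep G seq_scale V \<rho>"
    by unfold_locales
      (auto simp: linear_between_def V_def \<rho>_def fun_scale_def fun_eq_iff e_lt e'_in e'e ee' m_assoc)
  then interpret V: fd_rep G seq_scale V \<rho> .
  \<comment> \<open>The delta function at the identity. Its translate by \<open>k\<close>, evaluated
    at the identity, is 1 exactly for trivial \<open>k\<close>, so the sum takes the nonzero value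
    of \<open>d\<close> at the identity there.\<close>
  define f where "f = (\<lambda>i. if i = e \<one>\<^bsub>G\<^esub> then 1 else 0 :: complex)"
  have "f \<in> V" using e_lt[OF one_closed] by (auto simp: V_def f_def)
  moreover have "(\<Sum>k\<in>carrier G. seq_scale (d k) (\<rho> k f)) \<noteq> 0"
  proof -
    have "(\<Sum>k\<in>carrier G. seq_scale (d k) (\<rho> k f)) (e \<one>\<^bsub>G\<^esub>) = d \<one>\<^bsub>G\<^esub>"
    proof -
      have "(\<Sum>k\<in>carrier G. seq_scale (d k) (\<rho> k f)) (e \<one>\<^bsub>G\<^esub>)
          = (\<Sum>k\<in>carrier G. if k = \<one>\<^bsub>G\<^esub> then d k else 0)"
        unfolding sum_fun_apply'
      proof (intro sum.cong refl)
        fix k assume k: "k \<in> carrier G"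
        have "e k = e \<one>\<^bsub>G\<^esub> \<longleftrightarrow> k = \<one>\<^bsub>G\<^esub>" using e'e[OF k] e'e[OF one_closed] by metis
        then show "seq_scale (d k) (\<rho> k f) (e \<one>\<^bsub>G\<^esub>) = (if k = \<one>\<^bsub>G\<^esub> then d k else 0)"
          using k by (simp add: fun_scale_def \<rho>_def f_def e_lt e'e)
      qed
      then show ?thesis using fin by simp
    qed
    then show ?thesis using d by auto
  qed
  ultimately show ?thesis
    using V.ex_irreducible_subrep[OF fin] that by blast
qed

section \<open>Convolution on induced representations\<close>

text \<open>For complex-valued \<open>f\<close>, with multiplication as \<open>s\<close>, this is
  the product of the group algebra; for vector-valued \<open>f\<close> it is the action of the group
  algebra by left translations. One definition serves for both.\<close>

definition conv ::
  "('g, 'm) monoid_scheme \<Rightarrow> (complex \<Rightarrow> 'v::ab_group_add \<Rightarrow> 'v) \<Rightarrow> ('g \<Rightarrow> complex) \<Rightarrow> ('g \<Rightarrow> 'v) \<Rightarrow> 'g \<Rightarrow> 'v" where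
  "conv G s a f = (\<lambda>g. if g \<in> carrier G then \<Sum>x\<in>carrier G. s (a x) (f (inv\<^bsub>G\<^esub> x \<otimes>\<^bsub>G\<^esub> g)) else 0)"

definition conj_invariant :: "('g, 'm) monoid_scheme \<Rightarrow> 'g set \<Rightarrow> ('g \<Rightarrow> 'b) \<Rightarrow> bool" where
  "conj_invariant G K a \<longleftrightarrow> (\<forall>k\<in>K. \<forall>x\<in>carrier G. a (k \<otimes>\<^bsub>G\<^esub> x \<otimes>\<^bsub>G\<^esub> inv\<^bsub>G\<^esub> k) = a x)"

text \<open>Substituting k x k^-1 for x leaves \<open>a\<close> unchanged and turns the argument
  x^-1 k g of \<open>f\<close> into k x^-1 g, from which equivariance of \<open>f\<close> extracts
  \<open>\<rho> k\<close>.\<close>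

lemma conv_ind_space:
  assumes "group G" and K: "subgroup K G" and V: "fd_rep (G\<lparr>carrier := K\<rparr>) s V \<rho>"
    and a: "conj_invariant G K a"
  shows "linear_between (fun_scale s) (ind_space G K V \<rho>) (fun_scale s) (ind_space G K V \<rho>) (conv G s a)"
    (is "linear_between _ ?I _ _ _")
proof -
  interpret group G by fact
  interpret K: subgroup K G by fact
  interpret V: fd_rep "G\<lparr>carrier := K\<rparr>" s V \<rho> by fact
  have "conv G s a f \<in> ?I" if f: "f \<in> ?I" for f
  proof -
    have fV: "f x \<in> V" if "x \<in> carrier G" for x
      using f that by (simp add: ind_space_def)
    have "conv G s a f (k \<otimes>\<^bsub>G\<^esub> g) = \<rho> k (conv G s a f g)" if k: "k \<in> K" and g: "g \<in> carrier G" for k g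
    proof -
      have kG: "k \<in> carrier G" using k K.mem_carrier by blast
      have "conv G s a f (k \<otimes>\<^bsub>G\<^esub> g)
          = (\<Sum>x\<in>carrier G. s (a (k \<otimes>\<^bsub>G\<^esub> x \<otimes>\<^bsub>G\<^esub> inv\<^bsub>G\<^esub> k)) (f (inv\<^bsub>G\<^esub> (k \<otimes>\<^bsub>G\<^esub> x \<otimes>\<^bsub>G\<^esub> inv\<^bsub>G\<^esub> k) \<otimes>\<^bsub>G\<^esub> (k \<otimes>\<^bsub>G\<^esub> g))))"
        using kG g unfolding conv_def
        by (auto intro!: sum.reindex_bij_witness[of _ "\<lambda>x. k \<otimes>\<^bsub>G\<^esub> x \<otimes>\<^bsub>G\<^esub> inv\<^bsub>G\<^esub> k" "\<lambda>x. inv\<^bsub>G\<^esub> k \<otimes>\<^bsub>G\<^esub> x \<otimes>\<^bsub>G\<^esub> k"]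
            simp: m_assoc inv_mult_group inv_mult_cancel)
      also have "\<dots> = (\<Sum>x\<in>carrier G. \<rho> k (s (a x) (f (inv\<^bsub>G\<^esub> x \<otimes>\<^bsub>G\<^esub> g))))"
      proof (intro sum.cong refl)
        fix x assume x: "x \<in> carrier G"
        have "inv\<^bsub>G\<^esub> (k \<otimes>\<^bsub>G\<^esub> x \<otimes>\<^bsub>G\<^esub> inv\<^bsub>G\<^esub> k) \<otimes>\<^bsub>G\<^esub> (k \<otimes>\<^bsub>G\<^esub> g) = k \<otimes>\<^bsub>G\<^esub> (inv\<^bsub>G\<^esub> x \<otimes>\<^bsub>G\<^esub> g)"
          using kG x g by (simp add: inv_mult_group m_assoc inv_mult_cancel)
        moreover have "f (k \<otimes>\<^bsub>G\<^esub> (inv\<^bsub>G\<^esub> x \<otimes>\<^bsub>G\<^esub> g)) = \<rho> k (f (inv\<^bsub>G\<^esub> x \<otimes>\<^bsub>G\<^esub> g))"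
          using f k x g by (simp add: ind_space_def)
        ultimately show "s (a (k \<otimes>\<^bsub>G\<^esub> x \<otimes>\<^bsub>G\<^esub> inv\<^bsub>G\<^esub> k)) (f (inv\<^bsub>G\<^esub> (k \<otimes>\<^bsub>G\<^esub> x \<otimes>\<^bsub>G\<^esub> inv\<^bsub>G\<^esub> k) \<otimes>\<^bsub>G\<^esub> (k \<otimes>\<^bsub>G\<^esub> g)))
            = \<rho> k (s (a x) (f (inv\<^bsub>G\<^esub> x \<otimes>\<^bsub>G\<^esub> g)))"
          using a k x g by (simp add: conj_invariant_def V.rho_scale fV)
      qed
      also have "\<dots> = \<rho> k (conv G s a f g)"
        using k g by (simp add: conv_def V.rho_sum V.subspace_scale[OF V.subspace_V] fV)
      finally show ?thesis .
    qed
    then show ?thesis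
      using fV by (auto simp: ind_space_def conv_def intro!: V.subspace_sum V.subspace_scale V.subspace_V)
  qed
  moreover have "conv G s a (f + h) = conv G s a f + conv G s a h" for f h
    by (auto simp: conv_def fun_eq_iff V.scale_right_distrib sum.distrib)
  moreover have "conv G s a (fun_scale s c f) = fun_scale s c (conv G s a f)" for c f
    by (auto simp: conv_def fun_eq_iff fun_scale_def V.scale_sum_right mult.commute)
  ultimately show ?thesis by (auto simp: linear_between_def)
qed

text \<open>Left translations commute with right translations.\<close>

lemma conv_ind_action:
  assumes "group G" "g \<in> carrier G"
  shows "conv G s a (ind_action G g f) = ind_action G g (conv G s a f)"
proof -
  interpret group G by fact
  show ?thesis
    using assms(2) by (auto simp: conv_def ind_action_def fun_eq_iff m_assoc intro!: sum.cong)
qed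

text \<open>Successive convolutions act as the group algebra product; the substitution is y = x^-1
  w.\<close>

lemma conv_conv:
  assumes "group G" "vector_space s" and g: "g \<in> carrier G"
  shows "conv G s a (conv G s b f) g
    = (\<Sum>w\<in>carrier G. s (conv G (*) a b w) (f (inv\<^bsub>G\<^esub> w \<otimes>\<^bsub>G\<^esub> g)))"
proof -
  interpret group G by fact
  interpret vector_space s by fact
  have "conv G s a (conv G s b f) g
      = (\<Sum>x\<in>carrier G. \<Sum>y\<in>carrier G. s (a x * b y) (f (inv\<^bsub>G\<^esub> y \<otimes>\<^bsub>G\<^esub> (inv\<^bsub>G\<^esub> x \<otimes>\<^bsub>G\<^esub> g))))"
    using g by (simp add: conv_def scale_sum_right)
  also have "\<dots> = (\<Sum>x\<in>carrier G. \<Sum>w\<in>carrier G. s (a x * b (inv\<^bsub>G\<^esub> x \<otimes>\<^bsub>G\<^esub> w)) (f (inv\<^bsub>G\<^esub> w \<otimes>\<^bsub>G\<^esub> g)))"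
  proof (rule sum.cong[OF refl])
    fix x assume x: "x \<in> carrier G"
    show "(\<Sum>y\<in>carrier G. s (a x * b y) (f (inv\<^bsub>G\<^esub> y \<otimes>\<^bsub>G\<^esub> (inv\<^bsub>G\<^esub> x \<otimes>\<^bsub>G\<^esub> g))))
        = (\<Sum>w\<in>carrier G. s (a x * b (inv\<^bsub>G\<^esub> x \<otimes>\<^bsub>G\<^esub> w)) (f (inv\<^bsub>G\<^esub> w \<otimes>\<^bsub>G\<^esub> g)))"
      by (rule sum.reindex_bij_witness[of _ "\<lambda>w. inv\<^bsub>G\<^esub> x \<otimes>\<^bsub>G\<^esub> w" "\<lambda>y. x \<otimes>\<^bsub>G\<^esub> y"])
        (use x g in \<open>auto simp: m_assoc[symmetric] inv_mult_group\<close>)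
  qed
  also have "\<dots> = (\<Sum>w\<in>carrier G. \<Sum>x\<in>carrier G. s (a x * b (inv\<^bsub>G\<^esub> x \<otimes>\<^bsub>G\<^esub> w)) (f (inv\<^bsub>G\<^esub> w \<otimes>\<^bsub>G\<^esub> g)))"
    by (rule sum.swap)
  finally show ?thesis by (simp add: conv_def scale_sum_left)
qed

text \<open>If the commutator \<open>?c\<close> were nonzero at \<open>g\<close>, some irreducible
  representation of \<open>K\<close> would detect its restriction to the coset g \<open>K\<close>.
  On the representation induced from it both convolutions are equivariant and hence commute, so
  \<open>?c\<close> acts there as zero, a contradiction.\<close>

theorem strong_Gelfand_pair_conv_commute:
  fixes a b :: "'g \<Rightarrow> complex"
  assumes "group G" and fin: "finite (carrier G)" and K: "subgroup K G"
    and sg: "strong_Gelfand_pair G K"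
    and a: "conj_invariant G K a" and b: "conj_invariant G K b"
  shows "conv G (*) a b = conv G (*) b a"
proof
  fix g
  interpret group G by fact
  interpret K: subgroup K G by fact
  let ?c = "\<lambda>w. conv G (*) a b w - conv G (*) b a w"
  show "conv G (*) a b g = conv G (*) b a g"
  proof (rule ccontr)
    assume neq: "conv G (*) a b g \<noteq> conv G (*) b a g"
    then have g: "g \<in> carrier G" unfolding conv_def by presburger
    have "group (G\<lparr>carrier := K\<rparr>)" using K subgroup_imp_group by blast
    moreover have finK: "finite (carrier (G\<lparr>carrier := K\<rparr>))"
      using fin K.subset finite_subset by auto
    \<comment> \<open>The function that sends \<open>k\<close> to \<open>?c\<close> (g k^-1) has the
      value \<open>?c g\<close> at the identity, which is nonzero as the separation lemma
      requires.\<close>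
    ultimately obtain V \<rho> v where irr: "irreducible_rep (G\<lparr>carrier := K\<rparr>) seq_scale V \<rho>"
      and v: "v \<in> V" and nz: "(\<Sum>k\<in>K. seq_scale (?c (g \<otimes>\<^bsub>G\<^esub> inv\<^bsub>G\<^esub> k)) (\<rho> k v)) \<noteq> 0"
      using irreducible_reps_separate[of "G\<lparr>carrier := K\<rparr>" "\<lambda>k. ?c (g \<otimes>\<^bsub>G\<^esub> inv\<^bsub>G\<^esub> k)"] neq g by auto
    then interpret V: fd_rep "G\<lparr>carrier := K\<rparr>" seq_scale V \<rho> by (simp add: irreducible_rep_def)
    let ?I = "ind_space G K V \<rho>"
    \<comment> \<open>The element of the induced space that is supported on \<open>K\<close> and has
      value \<open>v\<close> at the identity. Convolving it with \<open>?c\<close> and evaluating at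
      \<open>g\<close> sees just the values of \<open>?c\<close> on g \<open>K\<close>.\<close>
    define f where "f = (\<lambda>x. if x \<in> K then \<rho> x v else 0)"
    have kx: "k \<otimes>\<^bsub>G\<^esub> x \<in> K \<longleftrightarrow> x \<in> K" if "k \<in> K" "x \<in> carrier G" for k x
    proof
      assume "k \<otimes>\<^bsub>G\<^esub> x \<in> K"
      then have "inv\<^bsub>G\<^esub> k \<otimes>\<^bsub>G\<^esub> (k \<otimes>\<^bsub>G\<^esub> x) \<in> K" using that by blast
      then show "x \<in> K" using that K.mem_carrier by (simp add: m_assoc[symmetric])
    qed (use that in blast)
    have "f \<in> ?I"
      using K.mem_carrier v V.rho_closed V.rho_mult V.rho_zero V.zero_mem
      by (auto simp: ind_space_def f_def kx)
    moreover have "multiplicity_free G (fun_scale seq_scale) ?I (ind_action G)"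
      using sg irr by (simp add: strong_Gelfand_pair_def)
    ultimately have "conv G seq_scale a (conv G seq_scale b f) = conv G seq_scale b (conv G seq_scale a f)"
      using multiplicity_free_commute[where A = "conv G seq_scale a" and B = "conv G seq_scale b"
          and V = ?I and \<rho> = "ind_action G"]
        fd_rep_induced[OF \<open>group G\<close> fin K V.fd_rep_axioms]
        conv_ind_space[OF \<open>group G\<close> K V.fd_rep_axioms a] conv_ind_space[OF \<open>group G\<close> K V.fd_rep_axioms b]
        conv_ind_action[OF \<open>group G\<close>] by blast
    then have "(\<Sum>w\<in>carrier G. seq_scale (?c w) (f (inv\<^bsub>G\<^esub> w \<otimes>\<^bsub>G\<^esub> g))) = 0"
      using conv_conv[OF \<open>group G\<close> vector_space_seq_scale g, of a b f]
        conv_conv[OF \<open>group G\<close> vector_space_seq_scale g, of b a f]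
      by (simp add: V.scale_left_diff_distrib sum_subtractf)
    also have "(\<Sum>w\<in>carrier G. seq_scale (?c w) (f (inv\<^bsub>G\<^esub> w \<otimes>\<^bsub>G\<^esub> g)))
        = (\<Sum>k\<in>carrier G. seq_scale (?c (g \<otimes>\<^bsub>G\<^esub> inv\<^bsub>G\<^esub> k)) (f k))"
      by (rule sum.reindex_bij_witness[of _ "\<lambda>k. g \<otimes>\<^bsub>G\<^esub> inv\<^bsub>G\<^esub> k" "\<lambda>w. inv\<^bsub>G\<^esub> w \<otimes>\<^bsub>G\<^esub> g"])
        (use g in \<open>auto simp: m_assoc inv_mult_group inv_mult_cancel\<close>)
    also have "\<dots> = (\<Sum>k\<in>K. seq_scale (?c (g \<otimes>\<^bsub>G\<^esub> inv\<^bsub>G\<^esub> k)) (\<rho> k v))"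
      by (rule sum.mono_neutral_cong_right) (use fin K.subset in \<open>auto simp: f_def\<close>)
    finally show False using nz by contradiction
  qed
qed

text \<open>The convolution of the two class indicators at y z counts factorisations of y z into a
  conjugate of \<open>y\<close> followed by one of \<open>z\<close>. The count is positive, so it
  stays positive with the classes interchanged.\<close>

corollary strong_Gelfand_pair_swap_conjugates:
  assumes "group G" and fin: "finite (carrier G)" and K: "subgroup K G"
    and "strong_Gelfand_pair G K" and y: "y \<in> carrier G" and z: "z \<in> carrier G"
  obtains k l where "k \<in> K" "l \<in> K"
    "y \<otimes>\<^bsub>G\<^esub> z = (k \<otimes>\<^bsub>G\<^esub> z \<otimes>\<^bsub>G\<^esub> inv\<^bsub>G\<^esub> k) \<otimes>\<^bsub>G\<^esub> (l \<otimes>\<^bsub>G\<^esub> y \<otimes>\<^bsub>G\<^esub> inv\<^bsub>G\<^esub> l)"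
proof -
  interpret group G by fact
  interpret K: subgroup K G by fact
  define C where "C u = (\<lambda>k. k \<otimes>\<^bsub>G\<^esub> u \<otimes>\<^bsub>G\<^esub> inv\<^bsub>G\<^esub> k) ` K" for u
  define \<chi> where "\<chi> u = (\<lambda>x. of_bool (x \<in> C u) :: complex)" for u
  have self: "u \<in> C u" if "u \<in> carrier G" for u
    using that by (auto simp: C_def image_iff intro!: bexI[of _ "\<one>\<^bsub>G\<^esub>"])
  have conj: "k \<otimes>\<^bsub>G\<^esub> x \<otimes>\<^bsub>G\<^esub> inv\<^bsub>G\<^esub> k \<in> C u" if "x \<in> C u" "k \<in> K" "u \<in> carrier G" for u k x
  proof -
    from that(1) obtain l where l: "l \<in> K" "x = l \<otimes>\<^bsub>G\<^esub> u \<otimes>\<^bsub>G\<^esub> inv\<^bsub>G\<^esub> l" by (auto simp: C_def)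
    then have "k \<otimes>\<^bsub>G\<^esub> x \<otimes>\<^bsub>G\<^esub> inv\<^bsub>G\<^esub> k = (k \<otimes>\<^bsub>G\<^esub> l) \<otimes>\<^bsub>G\<^esub> u \<otimes>\<^bsub>G\<^esub> inv\<^bsub>G\<^esub> (k \<otimes>\<^bsub>G\<^esub> l)"
      using that K.mem_carrier by (simp add: m_assoc inv_mult_group)
    then show ?thesis using l(1) that(2) by (auto simp: C_def)
  qed
  have inv: "conj_invariant G K (\<chi> u)" if u: "u \<in> carrier G" for u
  proof -
    have "k \<otimes>\<^bsub>G\<^esub> x \<otimes>\<^bsub>G\<^esub> inv\<^bsub>G\<^esub> k \<in> C u \<longleftrightarrow> x \<in> C u" if k: "k \<in> K" and x: "x \<in> carrier G" for k x
    proof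
      assume "k \<otimes>\<^bsub>G\<^esub> x \<otimes>\<^bsub>G\<^esub> inv\<^bsub>G\<^esub> k \<in> C u"
      from conj[OF this _ u, of "inv\<^bsub>G\<^esub> k"] show "x \<in> C u"
        using k x K.mem_carrier by (simp add: m_assoc inv_mult_cancel)
    qed (use conj that u in blast)
    then show ?thesis by (simp add: conj_invariant_def \<chi>_def)
  qed
  let ?g = "y \<otimes>\<^bsub>G\<^esub> z"
  have "conv G (*) (\<chi> y) (\<chi> z) ?g
      = (\<Sum>x\<in>carrier G. of_bool (x \<in> C y \<and> inv\<^bsub>G\<^esub> x \<otimes>\<^bsub>G\<^esub> ?g \<in> C z))"
    using y z by (simp add: conv_def \<chi>_def of_bool_conj)
  also have "\<dots> = of_nat (card {x \<in> carrier G. x \<in> C y \<and> inv\<^bsub>G\<^esub> x \<otimes>\<^bsub>G\<^esub> ?g \<in> C z})"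
    using fin by (simp add: of_bool_def sum.If_cases Int_def)
  also have "\<dots> \<noteq> 0"
  proof -
    have "y \<in> {x \<in> carrier G. x \<in> C y \<and> inv\<^bsub>G\<^esub> x \<otimes>\<^bsub>G\<^esub> ?g \<in> C z}"
      using self y z by (simp add: m_assoc[symmetric])
    then show ?thesis using fin by (auto simp: card_eq_0_iff)
  qed
  finally have "conv G (*) (\<chi> z) (\<chi> y) ?g \<noteq> 0"
    using strong_Gelfand_pair_conv_commute[OF assms(1-4) inv[OF y] inv[OF z]] by simp
  then have "(\<Sum>x\<in>carrier G. \<chi> z x * \<chi> y (inv\<^bsub>G\<^esub> x \<otimes>\<^bsub>G\<^esub> ?g)) \<noteq> 0"
    using y z by (simp add: conv_def)
  then obtain x where x: "x \<in> carrier G" "\<chi> z x * \<chi> y (inv\<^bsub>G\<^esub> x \<otimes>\<^bsub>G\<^esub> ?g) \<noteq> 0"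
    by (meson sum.not_neutral_contains_not_neutral)
  then have "x \<in> C z" "inv\<^bsub>G\<^esub> x \<otimes>\<^bsub>G\<^esub> ?g \<in> C y"
    by (auto simp: \<chi>_def split: if_splits)
  moreover have "?g = x \<otimes>\<^bsub>G\<^esub> (inv\<^bsub>G\<^esub> x \<otimes>\<^bsub>G\<^esub> ?g)"
    using x(1) y z by (simp add: m_assoc[symmetric])
  ultimately show ?thesis using that unfolding C_def by (metis (no_types, lifting) imageE)
qed

section \<open>Products of a labelled 4-cycle and a labelled 3-cycle\<close>

definition three_cycle :: "('a \<Rightarrow> 'a) \<Rightarrow> 'a \<Rightarrow> 'a \<Rightarrow> 'a \<Rightarrow> bool" where
  "three_cycle \<sigma> p q r \<longleftrightarrow> distinct [p, q, r] \<and> \<sigma> p = q \<and> \<sigma> q = r \<and> \<sigma> r = p \<and>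
     (\<forall>i. i \<notin> {p, q, r} \<longrightarrow> \<sigma> i = i)"

definition four_cycle :: "('a \<Rightarrow> 'a) \<Rightarrow> 'a \<Rightarrow> 'a \<Rightarrow> 'a \<Rightarrow> 'a \<Rightarrow> bool" where
  "four_cycle \<sigma> a b c d \<longleftrightarrow> distinct [a, b, c, d] \<and> \<sigma> a = b \<and> \<sigma> b = c \<and> \<sigma> c = d \<and> \<sigma> d = a \<and>
     (\<forall>i. i \<notin> {a, b, c, d} \<longrightarrow> \<sigma> i = i)"

text \<open>This pattern tells the two mirror images apart: it occurs in the cyclic word 001101 but
  not in 001011.\<close>

definition word_0011 :: "('a \<Rightarrow> 'a) \<Rightarrow> ('a \<Rightarrow> bool) \<Rightarrow> 'a \<Rightarrow> bool" where
  "word_0011 \<pi> L k \<longleftrightarrow> \<not> L k \<and> \<not> L (\<pi> k) \<and> L (\<pi> (\<pi> k)) \<and> L (\<pi> (\<pi> (\<pi> k)))"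

lemma three_cycle_distinct: "three_cycle \<sigma> p q r \<Longrightarrow> distinct [p, q, r]"
  and four_cycle_distinct: "four_cycle \<sigma> a b c d \<Longrightarrow> distinct [a, b, c, d]"
  unfolding three_cycle_def four_cycle_def by blast+

text \<open>The assumption on \<open>L\<close> is the multiplication rule of the wreath product: a
  label of the right factor at \<open>j\<close> is carried to \<open>\<tau> j\<close> and added
  there modulo 2. The 4-cycle has labels at \<open>b\<close> and \<open>d\<close>, the 3-cycle at
  all its points.\<close>

lemma no_word_0011_disjoint:
  assumes y: "three_cycle \<sigma> p q r" and z: "four_cycle \<tau> a b c d"
    and disj: "{a, b, c, d} \<inter> {p, q, r} = {}"
    and L: "\<And>j. L (\<tau> j) \<longleftrightarrow> (\<tau> j \<in> {b, d}) \<noteq> (j \<in> {p, q, r})"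
  shows "\<not> word_0011 (\<tau> \<circ> \<sigma>) L k"
proof -
  have d: "distinct [a, b, c, d, p, q, r]" "distinct [r, q, p, d, c, b, a]"
    using disj three_cycle_distinct[OF y] four_cycle_distinct[OF z] by auto
  note \<tau> = z[unfolded four_cycle_def, simplified] and \<sigma> = y[unfolded three_cycle_def, simplified]
  note dist = d(1)[simplified] d(2)[simplified]
  have L_vals: "\<not> L a" "L b" "\<not> L c" "L d" "L p" "L q" "L r"
    using L[of a] L[of b] L[of c] L[of d] L[of p] L[of q] L[of r] by (simp_all add: \<tau> dist)
  show ?thesis
  proof (cases "k \<in> {a, b, c, d, p, q, r}")
    case True
    then show ?thesis
      by (elim insertE emptyE) (simp_all add: word_0011_def L_vals \<tau> \<sigma> dist)
  next
    case False
    then have "\<not> L k" "\<tau> (\<sigma> k) = k" using L[of k] by (simp_all add: \<tau> \<sigma>)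
    then show ?thesis by (simp add: word_0011_def)
  qed
qed

text \<open>The label of the 3-cycle at the shared point \<open>a\<close> is carried to
  \<open>b\<close>, where it cancels the label of the 4-cycle. The cycle (a q r b c d) then reads
  011001.\<close>

lemma no_word_0011_meeting_unlabelled:
  assumes y: "three_cycle \<sigma> a q r" and z: "four_cycle \<tau> a b c d"
    and qr: "q \<notin> {a, b, c, d}" "r \<notin> {a, b, c, d}"
    and L: "\<And>j. L (\<tau> j) \<longleftrightarrow> (\<tau> j \<in> {b, d}) \<noteq> (j \<in> {a, q, r})"
  shows "\<not> word_0011 (\<tau> \<circ> \<sigma>) L k"
proof -
  have d: "distinct [a, b, c, d, q, r]" "distinct [r, q, d, c, b, a]"
    using qr three_cycle_distinct[OF y] four_cycle_distinct[OF z] by auto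
  note \<tau> = z[unfolded four_cycle_def, simplified] and \<sigma> = y[unfolded three_cycle_def, simplified]
  note dist = d(1)[simplified] d(2)[simplified]
  have L_vals: "\<not> L a" "\<not> L b" "\<not> L c" "L d" "L q" "L r"
    using L[of a] L[of b] L[of c] L[of d] L[of q] L[of r] by (simp_all add: \<tau> dist)
  show ?thesis
  proof (cases "k \<in> {a, b, c, d, q, r}")
    case True
    then show ?thesis
      by (elim insertE emptyE) (simp_all add: word_0011_def L_vals \<tau> \<sigma> dist)
  next
    case False
    then have "\<not> L k" "\<tau> (\<sigma> k) = k" using L[of k] by (simp_all add: \<tau> \<sigma>)
    then show ?thesis by (simp add: word_0011_def)
  qed
qed

text \<open>The label of the 3-cycle at the shared point \<open>b\<close> is carried to
  \<open>c\<close>, so that only \<open>a\<close> remains unlabelled on the 6-cycle.\<close>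

lemma no_word_0011_meeting_labelled:
  assumes y: "three_cycle \<sigma> b q r" and z: "four_cycle \<tau> a b c d"
    and qr: "q \<notin> {a, b, c, d}" "r \<notin> {a, b, c, d}"
    and L: "\<And>j. L (\<tau> j) \<longleftrightarrow> (\<tau> j \<in> {b, d}) \<noteq> (j \<in> {b, q, r})"
  shows "\<not> word_0011 (\<tau> \<circ> \<sigma>) L k"
proof -
  have d: "distinct [a, b, c, d, q, r]" "distinct [r, q, d, c, b, a]"
    using qr three_cycle_distinct[OF y] four_cycle_distinct[OF z] by auto
  note \<tau> = z[unfolded four_cycle_def, simplified] and \<sigma> = y[unfolded three_cycle_def, simplified]
  note dist = d(1)[simplified] d(2)[simplified]
  have L_vals: "\<not> L a" "L b" "L c" "L d" "L q" "L r"
    using L[of a] L[of b] L[of c] L[of d] L[of q] L[of r] by (simp_all add: \<tau> dist)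
  show ?thesis
  proof (cases "k \<in> {a, b, c, d, q, r}")
    case True
    then show ?thesis
      by (elim insertE emptyE) (simp_all add: word_0011_def L_vals \<tau> \<sigma> dist)
  next
    case False
    then have "\<not> L k" "\<tau> (\<sigma> k) = k" using L[of k] by (simp_all add: \<tau> \<sigma>)
    then show ?thesis by (simp add: word_0011_def)
  qed
qed

text \<open>Rotating the 4-cycle by two places preserves its word 0101, which reduces the four
  possible shared points to \<open>a\<close> and \<open>b\<close>.\<close>

lemma no_word_0011_meeting:
  assumes y: "three_cycle \<sigma> p q r" and z: "four_cycle \<tau> a b c d"
    and "p \<in> {a, b, c, d}" "q \<notin> {a, b, c, d}" "r \<notin> {a, b, c, d}"
    and L: "\<And>j. L (\<tau> j) \<longleftrightarrow> (\<tau> j \<in> {b, d}) \<noteq> (j \<in> {p, q, r})"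
  shows "\<not> word_0011 (\<tau> \<circ> \<sigma>) L k"
proof -
  have z': "four_cycle \<tau> c d a b" using z by (simp add: four_cycle_def) blast
  have L': "\<And>j. L (\<tau> j) \<longleftrightarrow> (\<tau> j \<in> {d, b}) \<noteq> (j \<in> {p, q, r})" using L by (simp add: insert_commute)
  from assms(3) consider "p = a" | "p = b" | "p = c" | "p = d" by blast
  then show ?thesis
  proof cases
    case 1 then show ?thesis using no_word_0011_meeting_unlabelled assms by metis
  next
    case 2 then show ?thesis using no_word_0011_meeting_labelled assms by metis
  next
    case 3
    show ?thesis
      by (rule no_word_0011_meeting_unlabelled[OF y[unfolded 3] z' _ _ L'[unfolded 3]]) (use assms in auto)
  next
    case 4
    show ?thesis
      by (rule no_word_0011_meeting_labelled[OF y[unfolded 4] z' _ _ L'[unfolded 4]]) (use assms in auto)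
  qed
qed

text \<open>Two cycles which together move at least six points share at most one point. The labels
  along the nontrivial cycles of the product read \<open>0101\<close> and \<open>111\<close> if they are disjoint,
  \<open>001011\<close> if they share an unlabelled point of the 4-cycle, and \<open>011111\<close> if they share a
  labelled one; none of these cyclic words contains \<open>0011\<close>.\<close>

lemma no_word_0011:
  assumes y: "three_cycle \<sigma> p q r" and z: "four_cycle \<tau> a b c d"
    and L: "\<And>j. L (\<tau> j) \<longleftrightarrow> (\<tau> j \<in> {b, d}) \<noteq> (j \<in> {p, q, r})"
    and S: "card S = 6" "\<And>i. i \<in> S \<Longrightarrow> (\<tau> \<circ> \<sigma>) i \<noteq> i"
  shows "\<not> word_0011 (\<tau> \<circ> \<sigma>) L k"
proof -
  let ?A = "{a, b, c, d}" and ?B = "{p, q, r}"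
  have "S \<subseteq> ?A \<union> ?B"
  proof
    fix i assume "i \<in> S"
    then have "\<tau> (\<sigma> i) \<noteq> i" using S(2) by simp
    then show "i \<in> ?A \<union> ?B"
      using y z unfolding three_cycle_def four_cycle_def by (metis UnCI)
  qed
  then have "card S \<le> card (?A \<union> ?B)" by (intro card_mono) auto
  moreover have "card ?A = 4" "card ?B = 3"
    using three_cycle_distinct[OF y] four_cycle_distinct[OF z] by simp_all
  moreover have "card (?A \<union> ?B) + card (?A \<inter> ?B) = card ?A + card ?B"
    by (rule card_Un_Int[symmetric]) auto
  ultimately have le: "card (?A \<inter> ?B) \<le> 1" using S(1) by linarith
  show ?thesis
  proof (cases "?A \<inter> ?B = {}")
    case True
    then show ?thesis using no_word_0011_disjoint[OF y z _ L] by blast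
  next
    case False
    then obtain t where t: "t \<in> ?A" "t \<in> ?B" by blast
    have uniq: "u \<notin> ?A" if "u \<in> ?B" "u \<noteq> t" for u
    proof
      assume "u \<in> ?A"
      then have "card {t, u} \<le> card (?A \<inter> ?B)" using t that by (intro card_mono) auto
      then show False using le that(2) by simp
    qed
    have rot: "three_cycle \<sigma> q r p" "three_cycle \<sigma> r p q"
      using y by (simp_all add: three_cycle_def) blast+
    have L': "\<And>j. L (\<tau> j) \<longleftrightarrow> (\<tau> j \<in> {b, d}) \<noteq> (j \<in> {q, r, p})"
      "\<And>j. L (\<tau> j) \<longleftrightarrow> (\<tau> j \<in> {b, d}) \<noteq> (j \<in> {r, p, q})"
      using L by (simp_all add: disj_ac)
    have d: "distinct [p, q, r]" using three_cycle_distinct[OF y] .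
    from t(2) consider "t = p" | "t = q" | "t = r" by blast
    then show ?thesis
    proof cases
      case 1
      show ?thesis by (rule no_word_0011_meeting[OF y z _ _ _ L]) (use 1 t uniq d in auto)
    next
      case 2
      show ?thesis by (rule no_word_0011_meeting[OF rot(1) z _ _ _ L'(1)]) (use 2 t uniq d in auto)
    next
      case 3
      show ?thesis by (rule no_word_0011_meeting[OF rot(2) z _ _ _ L'(2)]) (use 3 t uniq d in auto)
    qed
  qed
qed

section \<open>Conjugates in the hyperoctahedral group\<close>

lemma three_cycle_conj:
  assumes "three_cycle \<sigma> p q r" "bij \<tau>" and eq: "\<And>i. \<sigma>' (\<tau> i) = \<tau> (\<sigma> i)"
  shows "three_cycle \<sigma>' (\<tau> p) (\<tau> q) (\<tau> r)"
proof -
  have "\<sigma>' i = i" if "i \<notin> {\<tau> p, \<tau> q, \<tau> r}" for i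
  proof -
    obtain j where j: "i = \<tau> j" using assms(2) by (metis bij_pointE)
    then have "j \<notin> {p, q, r}" using that by blast
    then have "\<sigma> j = j" using assms(1) by (simp add: three_cycle_def)
    then show ?thesis by (simp add: j eq)
  qed
  then show ?thesis
    using assms(1) bij_is_inj[OF assms(2)] by (simp add: three_cycle_def eq inj_eq)
qed

lemma four_cycle_conj:
  assumes "four_cycle \<sigma> a b c d" "bij \<tau>" and eq: "\<And>i. \<sigma>' (\<tau> i) = \<tau> (\<sigma> i)"
  shows "four_cycle \<sigma>' (\<tau> a) (\<tau> b) (\<tau> c) (\<tau> d)"
proof -
  have "\<sigma>' i = i" if "i \<notin> {\<tau> a, \<tau> b, \<tau> c, \<tau> d}" for i
  proof -
    obtain j where j: "i = \<tau> j" using assms(2) by (metis bij_pointE)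
    then have "j \<notin> {a, b, c, d}" using that by blast
    then have "\<sigma> j = j" using assms(1) by (simp add: four_cycle_def)
    then show ?thesis by (simp add: j eq)
  qed
  then show ?thesis
    using assms(1) bij_is_inj[OF assms(2)] by (simp add: four_cycle_def eq inj_eq)
qed

abbreviation hyperoctahedral :: "nat \<Rightarrow> ((nat \<Rightarrow> int) \<times> (nat \<Rightarrow> nat)) monoid" where
  "hyperoctahedral n \<equiv> wreath_sym (integer_mod_group 2) n"

lemma group_integer_mod_2: "group (integer_mod_group 2)"
  by simp

lemma carrier_wreath_sym_2:
  "(f, \<sigma>) \<in> carrier (hyperoctahedral n) \<longleftrightarrow> f \<in> (\<Pi>\<^sub>E i\<in>{1..n}. {0, 1}) \<and> \<sigma> permutes {1..n}"
proof -
  have "{0..<2} = {0, 1 :: int}" by auto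
  then show ?thesis by (simp add: wreath_sym_def sym_group_def carrier_integer_mod_group)
qed

lemma mult_wreath_sym_2:
  "(f, \<sigma>) \<otimes>\<^bsub>hyperoctahedral n\<^esub> (h, \<tau>)
    = (\<lambda>i\<in>{1..n}. (f i + permute_coords n \<sigma> h i) mod 2, \<sigma> \<circ> \<tau>)"
  by (simp add: wreath_sym_def sym_group_def mult_integer_mod_group cong: restrict_cong)

text \<open>The constant label \<open>c\<close> of \<open>k\<close> cancels, so conjugation merely
  transports the permutation and its labels along \<open>\<tau>\<close>.\<close>

lemma conjugate_wreath_sym_2:
  assumes x: "(f, \<sigma>) \<in> carrier (hyperoctahedral n)"
    and k: "k \<in> diag_times_sym (integer_mod_group 2) n"
  obtains f' \<sigma>' \<tau> where "k \<otimes>\<^bsub>hyperoctahedral n\<^esub> (f, \<sigma>) \<otimes>\<^bsub>hyperoctahedral n\<^esub> inv\<^bsub>hyperoctahedral n\<^esub> k = (f', \<sigma>')"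
    "(f', \<sigma>') \<in> carrier (hyperoctahedral n)" "\<tau> permutes {1..n}" "\<And>i. \<sigma>' (\<tau> i) = \<tau> (\<sigma> i)"
    "\<And>i. i \<in> {1..n} \<Longrightarrow> f' (\<tau> i) = f i"
proof -
  interpret W: group "hyperoctahedral n" by (rule group_wreath_sym) simp
  obtain c \<tau> where k_eq: "k = (\<lambda>i\<in>{1..n}. c, \<tau>)" and \<tau>: "\<tau> permutes {1..n}"
    using k by (auto simp: diag_times_sym_def sym_group_def)
  have kW: "k \<in> carrier (hyperoctahedral n)"
    using k subgroup.mem_carrier[OF subgroup_diag_times_sym[OF group_integer_mod_2]] by blast
  obtain f' \<sigma>' where x': "k \<otimes>\<^bsub>hyperoctahedral n\<^esub> (f, \<sigma>) \<otimes>\<^bsub>hyperoctahedral n\<^esub> inv\<^bsub>hyperoctahedral n\<^esub> k = (f', \<sigma>')" by force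
  have x'W: "(f', \<sigma>') \<in> carrier (hyperoctahedral n)" unfolding x'[symmetric] using x kW by simp
  \<comment> \<open>Comparing x' k with k x avoids computing the inverse of \<open>k\<close>: at
    \<open>\<tau> i\<close> the two sides have labels \<open>f' (\<tau> i) + c\<close> and
    \<open>c + f i\<close>.\<close>
  have "(f', \<sigma>') \<otimes>\<^bsub>hyperoctahedral n\<^esub> k = k \<otimes>\<^bsub>hyperoctahedral n\<^esub> (f, \<sigma>)"
    unfolding x'[symmetric] using x kW by (simp add: W.m_assoc)
  then have labels: "(\<lambda>i\<in>{1..n}. (f' i + permute_coords n \<sigma>' (\<lambda>i\<in>{1..n}. c) i) mod 2)
      = (\<lambda>i\<in>{1..n}. ((\<lambda>i\<in>{1..n}. c) i + permute_coords n \<tau> f i) mod 2)"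
    and perms: "\<sigma>' \<circ> \<tau> = \<tau> \<circ> \<sigma>"
    unfolding k_eq mult_wreath_sym_2 by blast+
  have \<sigma>': "\<sigma>' permutes {1..n}" using x'W by (simp add: carrier_wreath_sym_2)
  have "f' (\<tau> i) = f i" if i: "i \<in> {1..n}" for i
  proof -
    have \<tau>i: "\<tau> i \<in> {1..n}" using \<tau> i permutes_in_image by metis
    then have "inv' \<sigma>' (\<tau> i) \<in> {1..n}" using \<sigma>' permutes_inv_mem by blast
    then have "(f' (\<tau> i) + c) mod 2 = (c + f i) mod 2"
      using fun_cong[OF labels, of "\<tau> i"] \<tau>i
      by (simp add: permute_coords_def permutes_inverses[OF \<tau>] del: atLeastAtMost_iff)
    moreover have "f' (\<tau> i) \<in> {0, 1}" "f i \<in> {0, 1}"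
      using x x'W \<tau>i i unfolding carrier_wreath_sym_2 by blast+
    ultimately show ?thesis by auto presburger+
  qed
  then show ?thesis
    using that x' x'W \<tau> perms by (metis comp_apply)
qed

section \<open>The two elements that contradict the strong Gelfand property\<close>

theorem mainTheorem5:
  fixes n :: nat
  assumes "n \<ge> 6"
  shows "\<not> strong_Gelfand_pair (wreath_sym (integer_mod_group 2) n)
            (diag_times_sym (integer_mod_group 2) n)"
proof
  let ?K = "diag_times_sym (integer_mod_group 2) n"
  assume sg: "strong_Gelfand_pair (hyperoctahedral n) ?K"
  \<comment> \<open>The 3-cycle (2 5 6), labelled everywhere, and the 4-cycle (1 2 3 4), labelled at
    2 and 4, share the point 2. Together they occupy exactly six points, which is where the bound on
    \<open>n\<close> enters.\<close>
  define \<sigma> :: "nat \<Rightarrow> nat" where "\<sigma> = transpose 2 5 \<circ> transpose 5 6"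
  define \<tau> :: "nat \<Rightarrow> nat" where "\<tau> = transpose 1 2 \<circ> transpose 2 3 \<circ> transpose 3 4"
  define f where "f = (\<lambda>i\<in>{1..n}. of_bool (i \<in> {2, 5, 6}) :: int)"
  define h where "h = (\<lambda>i\<in>{1..n}. of_bool (i \<in> {2, 4}) :: int)"
  have \<sigma>: "three_cycle \<sigma> 2 5 6" by (auto simp: \<sigma>_def three_cycle_def transpose_def)
  have \<tau>: "four_cycle \<tau> 1 2 3 4" by (auto simp: \<tau>_def four_cycle_def transpose_def)
  have perm: "\<sigma> permutes {1..n}" "\<tau> permutes {1..n}"
    unfolding \<sigma>_def \<tau>_def by (intro permutes_compose permutes_swap_id; use assms in simp)+
  have y: "(f, \<sigma>) \<in> carrier (hyperoctahedral n)" and z: "(h, \<tau>) \<in> carrier (hyperoctahedral n)"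
    using perm by (auto simp: carrier_wreath_sym_2 f_def h_def)
  have fin: "finite (carrier (hyperoctahedral n))"
    by (rule finite_carrier_wreath_sym) (simp add: carrier_integer_mod_group)
  obtain k l where kl: "k \<in> ?K" "l \<in> ?K"
    and swap: "(f, \<sigma>) \<otimes>\<^bsub>hyperoctahedral n\<^esub> (h, \<tau>) = (k \<otimes>\<^bsub>hyperoctahedral n\<^esub> (h, \<tau>) \<otimes>\<^bsub>hyperoctahedral n\<^esub> inv\<^bsub>hyperoctahedral n\<^esub> k) \<otimes>\<^bsub>hyperoctahedral n\<^esub> (l \<otimes>\<^bsub>hyperoctahedral n\<^esub> (f, \<sigma>) \<otimes>\<^bsub>hyperoctahedral n\<^esub> inv\<^bsub>hyperoctahedral n\<^esub> l)"
    using strong_Gelfand_pair_swap_conjugates[OF group_wreath_sym[OF group_integer_mod_2] fin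
        subgroup_diag_times_sym[OF group_integer_mod_2] sg y z] by blast
  obtain h' \<tau>' \<beta> where z': "k \<otimes>\<^bsub>hyperoctahedral n\<^esub> (h, \<tau>) \<otimes>\<^bsub>hyperoctahedral n\<^esub> inv\<^bsub>hyperoctahedral n\<^esub> k = (h', \<tau>')" "(h', \<tau>') \<in> carrier (hyperoctahedral n)"
    and \<beta>: "\<beta> permutes {1..n}" "\<And>i. \<tau>' (\<beta> i) = \<beta> (\<tau> i)" "\<And>i. i \<in> {1..n} \<Longrightarrow> h' (\<beta> i) = h i"
    using conjugate_wreath_sym_2[OF z kl(1)] by blast
  obtain f' \<sigma>' \<alpha> where y': "l \<otimes>\<^bsub>hyperoctahedral n\<^esub> (f, \<sigma>) \<otimes>\<^bsub>hyperoctahedral n\<^esub> inv\<^bsub>hyperoctahedral n\<^esub> l = (f', \<sigma>')" "(f', \<sigma>') \<in> carrier (hyperoctahedral n)"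
    and \<alpha>: "\<alpha> permutes {1..n}" "\<And>i. \<sigma>' (\<alpha> i) = \<alpha> (\<sigma> i)" "\<And>i. i \<in> {1..n} \<Longrightarrow> f' (\<alpha> i) = f i"
    using conjugate_wreath_sym_2[OF y kl(2)] by blast
  have \<sigma>': "three_cycle \<sigma>' (\<alpha> 2) (\<alpha> 5) (\<alpha> 6)"
    using three_cycle_conj[OF \<sigma> permutes_bij[OF \<alpha>(1)] \<alpha>(2)] .
  have \<tau>': "four_cycle \<tau>' (\<beta> 1) (\<beta> 2) (\<beta> 3) (\<beta> 4)"
    using four_cycle_conj[OF \<tau> permutes_bij[OF \<beta>(1)] \<beta>(2)] .
  define g where "g = (\<lambda>i\<in>{1..n}. (f i + permute_coords n \<sigma> h i) mod 2)"
  have g_swap: "g = (\<lambda>i\<in>{1..n}. (h' i + permute_coords n \<tau>' f' i) mod 2)"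
    and perm_swap: "\<sigma> \<circ> \<tau> = \<tau>' \<circ> \<sigma>'"
    using swap unfolding z'(1) y'(1) mult_wreath_sym_2 g_def by blast+
  \<comment> \<open>Points outside \<open>{1..n}\<close>, where \<open>g\<close> is
    \<open>undefined\<close>, count as unlabelled, so the multiplication rule for \<open>L\<close>
    holds at every natural number.\<close>
  define L where "L i \<longleftrightarrow> i \<in> {1..n} \<and> g i = 1" for i
  have f': "f' i = of_bool (i \<in> {\<alpha> 2, \<alpha> 5, \<alpha> 6})" if "i \<in> {1..n}" for i
  proof -
    obtain j where j: "i = \<alpha> j" using permutes_surj[OF \<alpha>(1)] by blast
    then have "j \<in> {1..n}" using that permutes_in_image[OF \<alpha>(1)] by blast
    then show ?thesis
      using \<alpha>(3)[of j] inj_eq[OF permutes_inj[OF \<alpha>(1)]] by (simp add: j f_def)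
  qed
  have h': "h' i = of_bool (i \<in> {\<beta> 2, \<beta> 4})" if "i \<in> {1..n}" for i
  proof -
    obtain j where j: "i = \<beta> j" using permutes_surj[OF \<beta>(1)] by blast
    then have "j \<in> {1..n}" using that permutes_in_image[OF \<beta>(1)] by blast
    then show ?thesis
      using \<beta>(3)[of j] inj_eq[OF permutes_inj[OF \<beta>(1)]] by (simp add: j h_def)
  qed
  have mem: "{\<alpha> 2, \<alpha> 5, \<alpha> 6} \<subseteq> {1..n}" "{\<beta> 2, \<beta> 4} \<subseteq> {1..n}"
    unfolding insert_subset permutes_in_image[OF \<alpha>(1)] permutes_in_image[OF \<beta>(1)]
    using assms by simp_all
  have parity: "(of_bool P + of_bool Q) mod 2 = (1 :: int) \<longleftrightarrow> P \<noteq> Q" for P Q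
    by (cases P; cases Q) simp_all
  have "L (\<tau>' j) \<longleftrightarrow> (\<tau>' j \<in> {\<beta> 2, \<beta> 4}) \<noteq> (j \<in> {\<alpha> 2, \<alpha> 5, \<alpha> 6})" for j
  proof -
    have perm': "\<tau>' permutes {1..n}" using z'(2) by (simp add: carrier_wreath_sym_2)
    have iff: "\<tau>' j \<in> {1..n} \<longleftrightarrow> j \<in> {1..n}" by (rule permutes_in_image[OF perm'])
    show ?thesis
    proof (cases "j \<in> {1..n}")
      case True
      then have \<tau>'j: "\<tau>' j \<in> {1..n}" using iff by blast
      have "g (\<tau>' j) = (h' (\<tau>' j) + f' j) mod 2"
        using \<tau>'j unfolding g_swap permute_coords_def
        by (simp only: restrict_apply if_True permutes_inverses(2)[OF perm'])
      also have "\<dots> = (of_bool (\<tau>' j \<in> {\<beta> 2, \<beta> 4}) + of_bool (j \<in> {\<alpha> 2, \<alpha> 5, \<alpha> 6})) mod 2"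
        by (simp only: h'[OF \<tau>'j] f'[OF True])
      finally show ?thesis
        using \<tau>'j unfolding L_def by (simp only: parity simp_thms)
    next
      case False
      have "\<tau>' j \<notin> {\<beta> 2, \<beta> 4}" "j \<notin> {\<alpha> 2, \<alpha> 5, \<alpha> 6}" using False iff mem by blast+
      then show ?thesis using False iff unfolding L_def by blast
    qed
  qed
  \<comment> \<open>The product equals \<open>\<sigma> \<circ> \<tau>\<close>, a 6-cycle; hence the
    conjugated cycles also move six points together.\<close>
  moreover have "(\<tau>' \<circ> \<sigma>') i \<noteq> i" if "i \<in> {1..6}" for i
  proof -
    have "i \<in> {1, 2, 3, 4, 5, 6}" using that by auto
    then show ?thesis unfolding perm_swap[symmetric]
      by (elim insertE emptyE) (simp_all add: \<sigma>_def \<tau>_def transpose_def)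
  qed
  ultimately have "\<not> word_0011 (\<tau>' \<circ> \<sigma>') L 1"
    by (intro no_word_0011[OF \<sigma>' \<tau>', where S = "{1..6}"]) auto
  \<comment> \<open>The cycle \<open>(1 5 6 2 3 4)\<close> of \<open>\<sigma> \<circ> \<tau>\<close> reads \<open>001101\<close>.\<close>
  moreover have "word_0011 (\<sigma> \<circ> \<tau>) L 1"
  proof -
    have inv_\<sigma>: "inv' \<sigma> 1 = 1" "inv' \<sigma> 5 = 2" "inv' \<sigma> 6 = 5" "inv' \<sigma> 2 = 6"
      by (rule inv_f_eq[OF permutes_inj[OF perm(1)]], simp add: \<sigma>_def transpose_def)+
    \<comment> \<open>The label of \<open>h\<close> at the shared point 2 is carried to 5 and
      cancels the label of \<open>f\<close> there.\<close>
    have "g 1 = 0" "g 5 = 0" "g 6 = 1" "g 2 = 1"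
      using assms by (simp_all add: g_def f_def h_def permute_coords_def inv_\<sigma> inv_\<sigma>[simplified])
    moreover have "(\<sigma> \<circ> \<tau>) 1 = 5" "(\<sigma> \<circ> \<tau>) 5 = 6" "(\<sigma> \<circ> \<tau>) 6 = 2"
      by (simp_all add: \<sigma>_def \<tau>_def transpose_def)
    ultimately show ?thesis using assms by (simp add: word_0011_def L_def del: comp_apply)
  qed
  ultimately show False by (simp add: perm_swap)
qed

end
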